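(* Let $R\subset\mathbb{N}$ be a good set. (i) Let $\alpha$ be irrational and let the nonnegative function $\rho\in L^1(\mu_{R,\alpha})$ satisfy $\int_{\mathbb{T}}\rho\,d\mu_{R,\alpha}=1$. Then there is an integrable $R$-weight $w$ with $M_R(w)=1$ which represents the measure $\rho\cdot\mu_{R,\alpha}$ at $\alpha$. If $\rho\in L^\infty(\mu_{R,\alpha})$, then the $R$-weight $w$ representing the measure $\rho\cdot\mu_{R,\alpha}$ can in addition be chosen to satisfy $\|w\|_\infty=\|\rho\|_{L^\infty(\mu_{R,\alpha})}$. (ii) Let $w$ be a good, integrable $R$-weight which satisfies $\|w\|_{1,R}>0$. Then for every $\beta\in\mathbb{T}$ the limit measure $\mu_{w,\beta}$ is absolutely continuous with respect to $\mu_{R,\beta}$.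
   Context: $\mathbb{N}=\{1,2,3,\dots\}$, $\mathbb{T}=\mathbb{R}/\mathbb{Z}$ and $e(\beta)=e^{2\pi i\beta}$. A good set $R\subset\mathbb{N}$ is an infinite set of positive integers which, when listed in increasing order as $r_1<r_2<\dots$, has the property that $\lim_{N\to\infty}\frac1N\sum_{n=1}^N e(r_n\beta)$ exists for every real number $\beta$. For a good set $R$ and every $\beta\in\mathbb{T}$, the weak limit of probability measures $\mu_{R,\beta}:=\lim_{N\to\infty}\frac1N\sum_{n=1}^N\delta_{r_n\beta}$ on $\mathbb{T}$ exists (with $r_n\beta$ taken mod $1$). Write $R(N)=R\cap[1,N]$. An $R$-weight is a function $w:R\to[0,\infty)$ with $\sum_{r\in R}w(r)=\infty$; $\|w\|_\infty$ is its supremum. Write $w(R(N))=\sum_{r\in R(N)}w(r)$. The $R$-weight $w$ is good if for every $\beta\in\mathbb{T}$ the weak limit $$\mu_{w,\beta}:=\lim_{N\to\infty}\frac{1}{w(R(N))}\sum_{r\in R(N)}w(r)\,\delta_{r\beta}$$ exists. The $R$-weight $w$ represents a Borel probability measure $\nu$ at $\alpha$ if $w$ is good and $\mu_{w,\alpha}=\nu$. For $f:R\to\mathbb{C}$, put $\|f\|_{1,R}=\limsup_{N\to\infty}\frac{1}{\#R(N)}\sum_{r\in R(N)}|f(r)|$ and $M_R(f)=\lim_{N\to\infty}\frac{1}{\#R(N)}\sum_{r\in R(N)}f(r)$ when the limit exists. An $R$-weight $w$ is integrable if for every $\epsilon>0$ there is a good $R$-weight $v$ with $\|v\|_\infty<\infty$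 such that $\|v-w\|_{1,R}<\epsilon$. *)

theory Defs
  imports "HOL-Probability.Probability"
begin

section \<open>The circle group \<open>\<real>/\<int>\<close>\<close>

quotient_type circle = real / "\<lambda>x y::real. x - y \<in> \<int>"
proof (rule equivpI)
  show "reflp (\<lambda>x y::real. x - y \<in> \<int>)"
    by (simp add: reflp_def)
  show "symp (\<lambda>x y::real. x - y \<in> \<int>)"
    by (rule sympI) (metis Ints_minus minus_diff_eq)
  show "transp (\<lambda>x y::real. x - y \<in> \<int>)"
  proof (rule transpI)
    fix x y z :: real
    assume "x - y \<in> \<int>" "y - z \<in> \<int>"
    then have "(x - y) + (y - z) \<in> \<int>" by (rule Ints_add)
    then show "x - z \<in> \<int>" by simp
  qed
qed

text \<open>Quotient topology; \<open>borel :: circle measure\<close> is then the Borel space of \<open>\<real>/\<int>\<close>.\<close>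

instantiation circle :: topological_space
begin

definition open_circle :: "circle set \<Rightarrow> bool" where
  "open_circle U \<longleftrightarrow> open (abs_circle -` U)"

instance
  by standard (auto simp: open_circle_def vimage_Union)

end

lift_definition circle_mult :: "nat \<Rightarrow> circle \<Rightarrow> circle" is "\<lambda>n x. real n * x"
  by (metis Ints_mult Ints_of_nat right_diff_distrib)


section \<open>Weak limits of measures on the circle\<close>

definition has_weak_limit :: "(nat \<Rightarrow> circle measure) \<Rightarrow> circle measure \<Rightarrow> bool" where
  "has_weak_limit M \<mu> \<longleftrightarrow> sets \<mu> = sets borel \<and> prob_space \<mu> \<and>
     (\<forall>f :: circle \<Rightarrow> real. continuous_on UNIV f \<longrightarrow>
        (\<lambda>N. \<integral>x. f x \<partial>(M N)) \<longlonglongrightarrow> (\<integral>x. f x \<partial>\<mu>))"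

definition weak_limit :: "(nat \<Rightarrow> circle measure) \<Rightarrow> circle measure" where
  "weak_limit M = (THE \<mu>. has_weak_limit M \<mu>)"


section \<open>Good sets\<close>

definition ee :: "real \<Rightarrow> complex" where
  "ee \<beta> = exp (2 * of_real pi * \<i> * of_real \<beta>)"

text \<open>\<open>enumerate R\<close> lists \<open>R\<close> increasingly starting from index \<open>0\<close>, so \<open>r\<^sub>n = enumerate R (n - 1)\<close>.\<close>

definition good_set :: "nat set \<Rightarrow> bool" where
  "good_set R \<longleftrightarrow> infinite R \<and> 0 \<notin> R \<and>
     (\<forall>\<beta>::real. convergent (\<lambda>N. (\<Sum>n<N. ee (real (enumerate R n) * \<beta>)) / of_nat N))"

definition empirical_measure :: "nat set \<Rightarrow> circle \<Rightarrow> nat \<Rightarrow> circle measure" where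
  "empirical_measure R \<beta> N =
     distr (uniform_count_measure {..<N}) borel (\<lambda>n. circle_mult (enumerate R n) \<beta>)"

definition limit_measure :: "nat set \<Rightarrow> circle \<Rightarrow> circle measure" where
  "limit_measure R \<beta> = weak_limit (empirical_measure R \<beta>)"


section \<open>Weights\<close>

text \<open>A function on \<open>R\<close> is represented by a function on \<open>nat\<close> whose values outside \<open>R\<close> are
  never used.\<close>

definition initial_segment :: "nat set \<Rightarrow> nat \<Rightarrow> nat set" where
  "initial_segment R N = R \<inter> {1..N}"

definition is_weight :: "nat set \<Rightarrow> (nat \<Rightarrow> real) \<Rightarrow> bool" where
  "is_weight R w \<longleftrightarrow> (\<forall>r\<in>R. 0 \<le> w r) \<and> filterlim (\<lambda>N. \<Sum>r\<in>initial_segment R N. w r) at_top sequentially"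

definition sup_norm :: "nat set \<Rightarrow> (nat \<Rightarrow> real) \<Rightarrow> ereal" where
  "sup_norm R w = (SUP r\<in>R. ereal (w r))"

text \<open>The measure \<open>(\<Sum>r\<in>R(N). w(r) \<delta>\<^sub>r\<^sub>\<beta>) / w(R(N))\<close>; it is the zero measure for the finitely many
  \<open>N\<close> with \<open>w(R(N)) = 0\<close>.\<close>

definition weighted_measure ::
    "nat set \<Rightarrow> (nat \<Rightarrow> real) \<Rightarrow> circle \<Rightarrow> nat \<Rightarrow> circle measure" where
  "weighted_measure R w \<beta> N =
     distr (point_measure (initial_segment R N) (\<lambda>r. ennreal (w r / (\<Sum>s\<in>initial_segment R N. w s))))
       borel (\<lambda>r. circle_mult r \<beta>)"

definition weight_limit_measure :: "nat set \<Rightarrow> (nat \<Rightarrow> real) \<Rightarrow> circle \<Rightarrow> circle measure" where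
  "weight_limit_measure R w \<beta> = weak_limit (weighted_measure R w \<beta>)"

definition good_weight :: "nat set \<Rightarrow> (nat \<Rightarrow> real) \<Rightarrow> bool" where
  "good_weight R w \<longleftrightarrow> is_weight R w \<and> (\<forall>\<beta>. \<exists>\<mu>. has_weak_limit (weighted_measure R w \<beta>) \<mu>)"

definition represents :: "nat set \<Rightarrow> (nat \<Rightarrow> real) \<Rightarrow> circle measure \<Rightarrow> circle \<Rightarrow> bool" where
  "represents R w \<nu> \<alpha> \<longleftrightarrow> good_weight R w \<and> weight_limit_measure R w \<alpha> = \<nu>"

definition seminorm1 :: "nat set \<Rightarrow> (nat \<Rightarrow> 'a::real_normed_vector) \<Rightarrow> ereal" where
  "seminorm1 R f =
     limsup (\<lambda>N. ereal ((\<Sum>r\<in>initial_segment R N. norm (f r)) / real (card (initial_segment R N))))"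

definition has_mean :: "nat set \<Rightarrow> (nat \<Rightarrow> 'a::real_normed_vector) \<Rightarrow> 'a \<Rightarrow> bool" where
  "has_mean R f m \<longleftrightarrow> (\<lambda>N. (\<Sum>r\<in>initial_segment R N. f r) /\<^sub>R real (card (initial_segment R N))) \<longlonglongrightarrow> m"

definition integrable_weight :: "nat set \<Rightarrow> (nat \<Rightarrow> real) \<Rightarrow> bool" where
  "integrable_weight R w \<longleftrightarrow> is_weight R w \<and>
     (\<forall>\<epsilon>::real. \<epsilon> > 0 \<longrightarrow> (\<exists>v. good_weight R v \<and> sup_norm R v < \<infinity> \<and>
        seminorm1 R (\<lambda>r. v r - w r) < ereal \<epsilon>))"

definition Linf_norm :: "circle measure \<Rightarrow> (circle \<Rightarrow> real) \<Rightarrow> ereal" where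
  "Linf_norm M f = esssup M (\<lambda>x. ereal \<bar>f x\<bar>)"

end

theory Submission
  imports Defs
begin

text \<open>
  The basic weights are \<open>r \<mapsto> \<phi>(r \<alpha>)\<close> with \<open>\<phi> \<ge> 0\<close> continuous on the circle. Multiplied by another sequence
  \<open>f(r \<beta>)\<close> they are uniform limits of finite sums of exponentials \<open>c e(r \<theta>)\<close>, whose averages along \<open>R\<close>
  converge by the very definition of a good set. So such a weight is good if its mean is positive, and at \<open>\<alpha>\<close> it represents
  a multiple of \<open>\<phi> \<cdot> \<mu>\<close>, where \<open>\<mu> = \<mu>\<^sub>R\<^sub>,\<^sub>\<alpha>\<close> (\<open>convergent_average\<close>, \<open>good_weightI\<close>).

  For a general density \<open>\<rho>\<close>, choose continuous \<open>\<phi>\<^sub>m\<close> converging to \<open>\<rho>\<close> rapidly in \<open>L\<^sup>1(\<mu>)\<close>. The averaged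
  seminorm of \<open>\<phi>\<^sub>m(r \<alpha>) - \<phi>\<^sub>n(r \<alpha>)\<close> is the \<open>L\<^sup>1(\<mu>)\<close> distance of \<open>\<phi>\<^sub>m\<close> and \<open>\<phi>\<^sub>n\<close>, so these weights form a
  Cauchy sequence, and the averaged seminorm is complete (\<open>seminorm_complete\<close>): a weight \<open>w\<close> that runs
  through the \<open>\<phi>\<^sub>m(r \<alpha>)\<close>, switching from one to the next slowly enough, is their limit. All averages
  \<open>w(r) f(r \<beta>)\<close> converge as limits of uniformly close convergent averages, and at \<open>\<alpha>\<close> the limit
  is \<open>\<integral> f \<rho> d\<mu>\<close> (\<open>representing_weight_exists\<close>). If \<open>\<rho>\<close> is essentially bounded, the \<open>\<phi>\<^sub>m\<close>, hence \<open>w\<close>, can be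
  kept below its essential supremum; conversely a bound \<open>w \<le> s\<close> gives \<open>\<integral> f \<rho> d\<mu> \<le> s \<integral> f d\<mu>\<close> for all continuous
  \<open>f \<ge> 0\<close> and therefore \<open>\<rho> \<le> s\<close> almost everywhere (\<open>AE_density_le_of_weight_le\<close>).

  For absolute continuity, compare \<open>w\<close> with a bounded weight \<open>v \<le> C\<close> at distance less than \<open>\<delta> \<epsilon>\<close>. The averages
  of \<open>w(r) f(r \<beta>)\<close> are at most \<open>C\<close> times those of \<open>f(r \<beta>)\<close> plus \<open>\<delta> \<epsilon>\<close>. Dividing by the averages of \<open>w\<close> along the
  infinitely many \<open>N\<close> at which they exceed some fixed \<open>\<delta> > 0\<close> yields
  \<open>\<integral> f d\<mu>\<^sub>w\<^sub>,\<^sub>\<beta> \<le> (C/\<delta>) \<integral> f d\<mu>\<^sub>R\<^sub>,\<^sub>\<beta> + \<epsilon>\<close> for \<open>0 \<le> f \<le> 1\<close>, which passes to Borel sets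
  (\<open>measure_le_of_continuous\<close>) and shows that null sets of \<open>\<mu>\<^sub>R\<^sub>,\<^sub>\<beta>\<close> are null for \<open>\<mu>\<^sub>w\<^sub>,\<^sub>\<beta>\<close>.
\<close>

section \<open>The circle as a compact subset of the complex plane\<close>

lemma abs_circle_eq_iff: "abs_circle x = abs_circle y \<longleftrightarrow> x - y \<in> \<int>"
  by (rule circle.abs_eq_iff)

lemma circle_cases: obtains x where "z = abs_circle x"
  using Quotient_abs_rep[OF Quotient_circle] by metis

lemma abs_circle_frac: "abs_circle (frac x) = abs_circle x"
  by (simp add: abs_circle_eq_iff frac_def)

lemma continuous_on_abs_circle: "continuous_on S abs_circle"
proof -
  have "continuous_on UNIV abs_circle"
    by (simp add: continuous_on_open_vimage open_circle_def)
  then show ?thesis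
    by (rule continuous_on_subset) simp
qed

lemma abs_circle_measurable [measurable]: "abs_circle \<in> borel_measurable borel"
  by (intro borel_measurable_continuous_onI continuous_on_abs_circle)

lemma compact_circle: "compact (UNIV :: circle set)"
proof -
  have "z \<in> abs_circle ` {0..1}" for z
  proof (rule circle_cases[of z])
    fix x assume "z = abs_circle x"
    then have "z = abs_circle (frac x)"
      by (simp add: abs_circle_frac)
    then show ?thesis
      using frac_ge_0 frac_lt_1 by (metis atLeastAtMost_iff imageI less_imp_le)
  qed
  then have "(UNIV :: circle set) = abs_circle ` {0..1}"
    by blast
  moreover have "compact (abs_circle ` {0..1})"
    by (intro compact_continuous_image continuous_on_abs_circle compact_Icc)
  ultimately show ?thesis
    by metis
qed

lemma ee_eq_cis: "ee x = cis (2 * pi * x)"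
  by (simp add: ee_def cis_conv_exp mult_ac)

lemma ee_add: "ee (x + y) = ee x * ee y"
  by (simp add: ee_eq_cis cis_mult algebra_simps)

lemma norm_ee [simp]: "norm (ee x) = 1"
  by (simp add: ee_eq_cis)

lemma ee_eq_iff: "ee x = ee y \<longleftrightarrow> x - y \<in> \<int>"
proof
  assume "ee x = ee y"
  then have "cis (2 * pi * (x - y)) = 1"
    by (simp add: ee_eq_cis right_diff_distrib flip: cis_divide)
  then have "cos (2 * pi * (x - y)) = 1"
    by (metis cis.sel(1) one_complex.sel(1))
  then obtain n :: int where "2 * pi * (x - y) = of_int n * 2 * pi"
    by (auto simp: cos_one_2pi_int)
  then have "x - y = of_int n"
    by simp
  then show "x - y \<in> \<int>"
    by simp
next
  assume "x - y \<in> \<int>"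
  then have "cis (2 * pi * (x - y)) = 1"
    by (rule cis_multiple_2pi)
  moreover have "ee x = ee (x - y) * ee y"
    by (simp flip: ee_add)
  ultimately show "ee x = ee y"
    by (simp add: ee_eq_cis)
qed

lift_definition circle_exp :: "circle \<Rightarrow> complex" is ee
  by (simp add: ee_eq_iff)

lemma circle_exp_abs [simp]: "circle_exp (abs_circle x) = ee x"
  by (rule circle_exp.abs_eq)

lemma circle_mult_abs: "circle_mult n (abs_circle x) = abs_circle (real n * x)"
  by (rule circle_mult.abs_eq)

lemma norm_circle_exp [simp]: "norm (circle_exp z) = 1"
  by (rule circle_cases[of z]) simp

lemma inj_circle_exp: "inj circle_exp"
proof (rule injI)
  fix y z assume "circle_exp y = circle_exp z"
  then show "y = z"
    by (metis circle_cases circle_exp_abs ee_eq_iff abs_circle_eq_iff)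
qed

lemma continuous_on_circle_exp: "continuous_on S circle_exp"
proof -
  have "continuous_on UNIV ee"
    unfolding ee_def by (intro continuous_intros)
  then have "open (ee -` B)" if "open B" for B
    using that by (auto simp: continuous_on_open_vimage)
  then have "continuous_on UNIV circle_exp"
    by (auto simp: continuous_on_open_vimage open_circle_def vimage_def)
  then show ?thesis
    by (rule continuous_on_subset) simp
qed

text \<open>A continuous bijection from a compact space onto a Hausdorff space has a continuous inverse, so
  continuous functions on the circle are the restrictions of continuous functions on the unit circle
  of the plane, to which the approximation theorems of metric and Euclidean spaces apply.\<close>

lemma continuous_on_inv_circle_exp: "continuous_on (range circle_exp) (inv circle_exp)"
  by (intro continuous_on_inv continuous_on_circle_exp compact_circle) (simp add: inj_circle_exp)

lemma continuous_circle_bounded: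
  fixes f :: "circle \<Rightarrow> real"
  assumes "continuous_on UNIV f"
  obtains B where "B > 0" "\<And>x. \<bar>f x\<bar> \<le> B"
proof -
  have "bounded (range f)"
    using assms compact_circle by (intro compact_imp_bounded compact_continuous_image)
  then show ?thesis
    using that by (auto simp: bounded_pos)
qed

lemma integrable_continuous_circle:
  fixes f :: "circle \<Rightarrow> real"
  assumes "continuous_on UNIV f" "finite_measure M" "sets M = sets borel"
  shows "integrable M f"
proof -
  interpret finite_measure M by fact
  obtain B where "\<And>x. \<bar>f x\<bar> \<le> B"
    using continuous_circle_bounded[OF assms(1)] by metis
  moreover have "f \<in> borel_measurable M"
    using borel_measurable_continuous_onI[OF assms(1)] assms(3) by (simp cong: measurable_cong_sets)
  ultimately show ?thesis
    by (intro integrable_const_bound[where B=B]) auto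
qed

lemma borel_circle_eq_sigma: "sets borel = sigma_sets UNIV (Collect open)"
  by (simp add: borel_def)

text \<open>The circle carries no metric of its own; distances are measured in the plane, where the complement
  of an open set has a compact image.\<close>

lemma open_indicator_limit:
  fixes U :: "circle set"
  assumes "open U"
  obtains g :: "nat \<Rightarrow> circle \<Rightarrow> real"
  where "\<And>n. continuous_on UNIV (g n)" "\<And>n x. 0 \<le> g n x" "\<And>n x. g n x \<le> 1"
    "\<And>x. (\<lambda>n. g n x) \<longlonglongrightarrow> indicator U x"
proof -
  \<comment> \<open>The centre of the unit circle only keeps the set nonempty when \<open>U\<close> is everything.\<close>
  define K where "K = insert 0 (circle_exp ` (- U))"
  have "compact (UNIV \<inter> (- U))"
    using compact_circle assms by (intro compact_Int_closed) auto
  then have "compact (circle_exp ` (- U))"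
    by (intro compact_continuous_image continuous_on_circle_exp) simp
  then have K: "closed K" "K \<noteq> {}"
    by (auto simp: K_def intro!: closed_insert compact_imp_closed)
  have in_K: "circle_exp x \<in> K \<longleftrightarrow> x \<notin> U" for x
    using norm_circle_exp[of x] inj_circle_exp by (auto simp: K_def inj_def simp del: norm_circle_exp)
  define g where "g n x = min 1 (real n * infdist (circle_exp x) K)" for n x
  show ?thesis
  proof
    show "continuous_on UNIV (g n)" for n
      unfolding g_def by (intro continuous_intros continuous_on_circle_exp)
    show "0 \<le> g n x" "g n x \<le> 1" for n x
      by (auto simp: g_def infdist_nonneg)
    show "(\<lambda>n. g n x) \<longlonglongrightarrow> indicator U x" for x
    proof (cases "x \<in> U")
      case False
      then have "infdist (circle_exp x) K = 0"
        using in_K K by (simp add: in_closed_iff_infdist_zero)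
      with False show ?thesis
        by (simp add: g_def)
    next
      case True
      then have d: "infdist (circle_exp x) K > 0"
        using in_K K infdist_pos_not_in_closed by blast
      obtain n0 where n0: "1 \<le> real n0 * infdist (circle_exp x) K"
        using reals_Archimedean3[OF d] less_imp_le by blast
      have "g n x = 1" if "n \<ge> n0" for n
      proof -
        have "real n0 * infdist (circle_exp x) K \<le> real n * infdist (circle_exp x) K"
          using that d by (intro mult_right_mono) auto
        with n0 show ?thesis
          by (simp add: g_def)
      qed
      then have "eventually (\<lambda>n. g n x = indicator U x) sequentially"
        using True by (auto simp: eventually_sequentially)
      then show ?thesis
        by (rule tendsto_eventually)
    qed
  qed
qed

section \<open>Continuous functions approximate integrable ones\<close>

text \<open>The Borel sets whose indicators can be approximated form a Dynkin system containing the open sets.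
  One approximant has to serve several measures at once, because measures that are not known to be
  related are compared below through their integrals of one continuous function.\<close>

lemma continuous_approx_indicator_aux:
  fixes MM :: "circle measure set"
  assumes fin: "finite MM" and MM: "\<And>M. M \<in> MM \<Longrightarrow> finite_measure M \<and> sets M = sets borel"
    and A: "A \<in> sets borel" and "e > 0"
  shows "\<exists>\<phi> :: circle \<Rightarrow> real. continuous_on UNIV \<phi> \<and> (\<forall>M\<in>MM. (\<integral>x. \<bar>\<phi> x - indicator A x\<bar> \<partial>M) < e)"
proof -
  have ind [simp]: "integrable M (\<lambda>x. indicator B x :: real)" if "M \<in> MM" "B \<in> sets borel" for M and B
    using that MM by (intro integrable_real_indicator)
       (auto simp: finite_measure.emeasure_finite simp flip: less_top)
  have int: "integrable M (\<lambda>x. \<bar>\<phi> x - indicator B x :: real\<bar>)"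
    if "M \<in> MM" "B \<in> sets borel" "continuous_on UNIV \<phi>" for M B \<phi>
    using that integrable_continuous_circle[of \<phi>] MM by (intro integrable_abs Bochner_Integration.integrable_diff ind) auto
  have "Int_stable (Collect open :: circle set set)" "Collect open \<subseteq> Pow (UNIV :: circle set)"
    by (auto simp: Int_stable_def)
  moreover have "A \<in> sigma_sets UNIV (Collect open)"
    using A by (simp add: borel_circle_eq_sigma)
  ultimately show ?thesis
    using \<open>e > 0\<close>
  proof (induction arbitrary: e rule: sigma_sets_induct_disjoint)
    case (basic U)
    then have U: "open U"
      by simp
    obtain g :: "nat \<Rightarrow> circle \<Rightarrow> real" where g: "\<And>n. continuous_on UNIV (g n)" "\<And>n x. 0 \<le> g n x" "\<And>n x. g n x \<le> 1"
    "\<And>x. (\<lambda>n. g n x) \<longlonglongrightarrow> indicator U x"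
      using open_indicator_limit[OF U] by metis
    have "(\<lambda>n. \<integral>x. \<bar>g n x - indicator U x\<bar> \<partial>M) \<longlonglongrightarrow> (\<integral>x. 0 \<partial>M)" if M: "M \<in> MM" for M
    proof (rule integral_dominated_convergence[where w="\<lambda>x. 1"])
      interpret finite_measure M using MM M by auto
      show "integrable M (\<lambda>x. 1 :: real)"
        by simp
      show "(\<lambda>x. \<bar>g n x - indicator U x\<bar>) \<in> borel_measurable M" for n
        using int[OF M _ g(1)] U by auto
      have "(\<lambda>n. \<bar>g n x - indicator U x\<bar>) \<longlonglongrightarrow> 0" for x
        using tendsto_rabs[OF tendsto_diff[OF g(4)[of x] tendsto_const[of "indicator U x"]]] by simp
      then show "AE x in M. (\<lambda>n. \<bar>g n x - indicator U x\<bar>) \<longlonglongrightarrow> 0"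
        by simp
      show "AE x in M. norm \<bar>g n x - indicator U x\<bar> \<le> 1" for n
        using g(2,3) by (auto simp: indicator_def)
    qed auto
    then have "eventually (\<lambda>n. (\<integral>x. \<bar>g n x - indicator U x\<bar> \<partial>M) < e) sequentially" if "M \<in> MM" for M
      using that \<open>e > 0\<close> by (intro order_tendstoD(2)[where y=0]) auto
    then have "eventually (\<lambda>n. \<forall>M\<in>MM. (\<integral>x. \<bar>g n x - indicator U x\<bar> \<partial>M) < e) sequentially"
      using fin by (simp add: eventually_ball_finite)
    then obtain n where "\<forall>M\<in>MM. (\<integral>x. \<bar>g n x - indicator U x\<bar> \<partial>M) < e"
      using eventually_happens' sequentially_bot by blast
    then show ?case
      using g(1) by blast
  next
    case empty
    then show ?case
      by (intro exI[of _ "\<lambda>x. 0"]) auto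
  next
    case (compl B)
    then obtain \<phi> :: "circle \<Rightarrow> real" where \<phi>: "continuous_on UNIV \<phi>"
      "\<And>M. M \<in> MM \<Longrightarrow> (\<integral>x. \<bar>\<phi> x - indicator B x\<bar> \<partial>M) < e"
      by meson
    have "\<bar>(1 - \<phi> x) - indicator (UNIV - B) x\<bar> = \<bar>\<phi> x - indicator B x\<bar>" for x
      by (auto simp: indicator_def)
    then show ?case
      using \<phi> by (intro exI[of _ "\<lambda>x. 1 - \<phi> x"]) (auto intro!: continuous_intros)
  next
    case (union D)
    have D: "D i \<in> sets borel" for i
      using union(2) by (auto simp: borel_circle_eq_sigma)
    define S where "S n = (\<Union>i<n. D i)" for n
    have [measurable]: "S n \<in> sets borel" "(\<Union>i. D i) \<in> sets borel" for n
      using D by (auto simp: S_def)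
    have S_ind: "indicator (S n) x = (\<Sum>i<n. indicator (D i) x :: real)" for n x
      unfolding S_def using union(1) by (intro indicator_UN_disjoint) (auto simp: disjoint_family_on_def)
    have "(\<lambda>n. \<integral>x. \<bar>indicator (S n) x - indicator (\<Union>i. D i) x :: real\<bar> \<partial>M) \<longlonglongrightarrow> (\<integral>x. 0 \<partial>M)" if M: "M \<in> MM" for M
    proof (rule integral_dominated_convergence[where w="\<lambda>x. 1"])
      interpret finite_measure M using MM M by auto
      show "integrable M (\<lambda>x. 1 :: real)"
        by simp
      show "(\<lambda>x. \<bar>indicator (S n) x - indicator (\<Union>i. D i) x :: real\<bar>) \<in> borel_measurable M" for n
        using M by (intro borel_measurable_integrable integrable_abs Bochner_Integration.integrable_diff ind) auto
      have "eventually (\<lambda>n. \<bar>indicator (S n) x - indicator (\<Union>i. D i) x :: real\<bar> = 0) sequentially" for x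
      proof (cases "x \<in> (\<Union>i. D i)")
        case True
        then obtain i where "x \<in> D i" by blast
        then show ?thesis
          by (intro eventually_sequentiallyI[of "Suc i"]) (auto simp: S_def indicator_def)
      qed (auto simp: S_def indicator_def)
      then show "AE x in M. (\<lambda>n. \<bar>indicator (S n) x - indicator (\<Union>i. D i) x :: real\<bar>) \<longlonglongrightarrow> 0"
        by (auto intro!: tendsto_eventually)
      show "AE x in M. norm \<bar>indicator (S n) x - indicator (\<Union>i. D i) x :: real\<bar> \<le> 1" for n
        by (auto simp: indicator_def)
    qed auto
    then have "eventually (\<lambda>n. (\<integral>x. \<bar>indicator (S n) x - indicator (\<Union>i. D i) x :: real\<bar> \<partial>M) < e / 2) sequentially" if "M \<in> MM" for M
      using that \<open>e > 0\<close> by (intro order_tendstoD(2)[where y=0]) auto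
    then have "eventually (\<lambda>n. \<forall>M\<in>MM. (\<integral>x. \<bar>indicator (S n) x - indicator (\<Union>i. D i) x :: real\<bar> \<partial>M) < e / 2) sequentially"
      using fin by (simp add: eventually_ball_finite)
    then obtain n where n: "\<And>M. M \<in> MM \<Longrightarrow> (\<integral>x. \<bar>indicator (S n) x - indicator (\<Union>i. D i) x :: real\<bar> \<partial>M) < e / 2"
      using eventually_happens' sequentially_bot by blast
    \<comment> \<open>Half of the tolerance is spent on truncating the union, the rest is shared by the \<open>n\<close> pieces.\<close>
    define d where "d = e / (2 * (real n + 1))"
    have "d > 0"
      using \<open>e > 0\<close> by (simp add: d_def)
    then have "\<exists>\<phi> :: circle \<Rightarrow> real. continuous_on UNIV \<phi> \<and> (\<forall>M\<in>MM. (\<integral>x. \<bar>\<phi> x - indicator (D i) x\<bar> \<partial>M) < d)" for i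
      using union(3) by blast
    then obtain \<phi> :: "nat \<Rightarrow> circle \<Rightarrow> real" where \<phi>: "\<And>i. continuous_on UNIV (\<phi> i)"
      "\<And>i M. M \<in> MM \<Longrightarrow> (\<integral>x. \<bar>\<phi> i x - indicator (D i) x\<bar> \<partial>M) < d"
      by metis
    define \<psi> where "\<psi> x = (\<Sum>i<n. \<phi> i x)" for x
    have \<psi>: "continuous_on UNIV \<psi>"
      unfolding \<psi>_def by (intro continuous_intros \<phi>)
    have "(\<integral>x. \<bar>\<psi> x - indicator (\<Union>i. D i) x\<bar> \<partial>M) < e" if M: "M \<in> MM" for M
    proof -
      have i1: "integrable M (\<lambda>x. \<bar>indicator (S n) x - indicator (\<Union>i. D i) x :: real\<bar>)"
        using M by (intro integrable_abs Bochner_Integration.integrable_diff ind) auto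
      have i2: "integrable M (\<lambda>x. \<Sum>i<n. \<bar>\<phi> i x - indicator (D i) x\<bar>)"
        by (intro Bochner_Integration.integrable_sum int M D \<phi>)
      have "\<bar>\<psi> x - indicator (\<Union>i. D i) x\<bar> \<le>
          (\<Sum>i<n. \<bar>\<phi> i x - indicator (D i) x\<bar>) + \<bar>indicator (S n) x - indicator (\<Union>i. D i) x\<bar>" for x
      proof -
        have "\<bar>\<psi> x - indicator (S n) x\<bar> = \<bar>\<Sum>i<n. \<phi> i x - indicator (D i) x\<bar>"
          by (simp add: S_ind \<psi>_def sum_subtractf)
        also have "\<dots> \<le> (\<Sum>i<n. \<bar>\<phi> i x - indicator (D i) x\<bar>)"
          by (rule sum_abs)
        finally show ?thesis
          by linarith
      qed
      then have "(\<integral>x. \<bar>\<psi> x - indicator (\<Union>i. D i) x\<bar> \<partial>M) \<le>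
          (\<integral>x. (\<Sum>i<n. \<bar>\<phi> i x - indicator (D i) x\<bar>) + \<bar>indicator (S n) x - indicator (\<Union>i. D i) x\<bar> \<partial>M)"
        using M by (intro integral_mono Bochner_Integration.integrable_add i1 i2 int \<psi>) auto
      also have "\<dots> = (\<Sum>i<n. \<integral>x. \<bar>\<phi> i x - indicator (D i) x\<bar> \<partial>M) + (\<integral>x. \<bar>indicator (S n) x - indicator (\<Union>i. D i) x\<bar> \<partial>M)"
        using i1 i2 int[OF M D \<phi>(1)] by (simp add: Bochner_Integration.integral_sum)
      also have "\<dots> < (\<Sum>i<n. d) + e / 2"
        using \<phi>(2)[OF M] n[OF M] by (intro add_le_less_mono sum_mono less_imp_le)
      also have "\<dots> \<le> e"
        using \<open>e > 0\<close> by (simp add: d_def field_simps)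
      finally show ?thesis .
    qed
    then show ?case
      using \<psi> by blast
  qed
qed

lemma continuous_approx_indicator:
  fixes M N :: "circle measure"
  assumes M: "finite_measure M" "sets M = sets borel" and N: "finite_measure N" "sets N = sets borel"
    and A: "A \<in> sets borel" and "e > 0"
  obtains \<phi> :: "circle \<Rightarrow> real" where "continuous_on UNIV \<phi>" "\<And>x. 0 \<le> \<phi> x" "\<And>x. \<phi> x \<le> 1"
    "\<bar>(\<integral>x. \<phi> x \<partial>M) - measure M A\<bar> < e" "\<bar>(\<integral>x. \<phi> x \<partial>N) - measure N A\<bar> < e"
proof -
  obtain \<psi> :: "circle \<Rightarrow> real" where \<psi>: "continuous_on UNIV \<psi>"
    "\<And>L. L \<in> {M, N} \<Longrightarrow> (\<integral>x. \<bar>\<psi> x - indicator A x\<bar> \<partial>L) < e"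
    using continuous_approx_indicator_aux[of "{M, N}" A e] assms by blast
  define \<phi> where "\<phi> x = max 0 (min 1 (\<psi> x))" for x
  have \<phi>: "continuous_on UNIV \<phi>"
    unfolding \<phi>_def by (intro continuous_intros \<psi>)
  have "\<bar>(\<integral>x. \<phi> x \<partial>L) - measure L A\<bar> < e" if L: "L \<in> {M, N}" for L
  proof -
    interpret finite_measure L using L M N by auto
    have [simp]: "sets L = sets borel" using L M N by auto
    have i: "integrable L \<phi>" "integrable L \<psi>" "integrable L (\<lambda>x. indicator A x :: real)"
      using A by (auto intro!: integrable_continuous_circle \<phi> \<psi> finite_measure_axioms
        integrable_real_indicator simp: emeasure_finite less_top[symmetric])
    have "(\<integral>x. \<phi> x \<partial>L) - measure L A = (\<integral>x. \<phi> x - indicator A x \<partial>L)"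
      using i A by (simp add: sets_eq_imp_space_eq[of L borel])
    also have "\<bar>\<dots>\<bar> \<le> (\<integral>x. \<bar>\<phi> x - indicator A x\<bar> \<partial>L)"
      by (rule integral_abs_bound)
    also have "\<dots> \<le> (\<integral>x. \<bar>\<psi> x - indicator A x\<bar> \<partial>L)"
      using i by (intro integral_mono integrable_abs Bochner_Integration.integrable_diff)
        (auto simp: \<phi>_def indicator_def)
    also have "\<dots> < e"
      using \<psi>(2) L by blast
    finally show ?thesis .
  qed
  then show ?thesis
    using that[of \<phi>] \<phi> by (auto simp: \<phi>_def)
qed

lemma continuous_approx_integrable_aux:
  fixes \<rho> :: "circle \<Rightarrow> real"
  assumes "integrable M \<rho>" "finite_measure M" "sets M = sets borel" "e > 0"
  shows "\<exists>\<phi>. continuous_on UNIV \<phi> \<and> (\<integral>x. \<bar>\<phi> x - \<rho> x\<bar> \<partial>M) < e"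
  using assms(1,4)
proof (induction arbitrary: e)
  case (base A c)
  have "e / (\<bar>c\<bar> + 1) > 0"
    using base by simp
  then obtain \<phi> :: "circle \<Rightarrow> real" where \<phi>: "continuous_on UNIV \<phi>" "(\<integral>x. \<bar>\<phi> x - indicator A x\<bar> \<partial>M) < e / (\<bar>c\<bar> + 1)"
    using continuous_approx_indicator_aux[of "{M}" A "e / (\<bar>c\<bar> + 1)"] assms base by auto
  have "(\<integral>x. \<bar>\<phi> x * c - indicator A x *\<^sub>R c\<bar> \<partial>M) = (\<integral>x. \<bar>c\<bar> * \<bar>\<phi> x - indicator A x\<bar> \<partial>M)"
    by (intro Bochner_Integration.integral_cong) (auto simp: algebra_simps simp flip: abs_mult)
  also have "\<dots> = \<bar>c\<bar> * (\<integral>x. \<bar>\<phi> x - indicator A x\<bar> \<partial>M)"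
    by simp
  also have "\<dots> \<le> \<bar>c\<bar> * (e / (\<bar>c\<bar> + 1))"
    using \<phi> by (intro mult_left_mono) auto
  also have "\<dots> < e"
    using base by (simp add: field_simps)
  finally show ?case
    using \<phi>(1) by (intro exI[of _ "\<lambda>x. \<phi> x * c"]) (auto intro!: continuous_intros)
next
  case (add f g)
  obtain \<phi> where \<phi>: "continuous_on UNIV \<phi>" "(\<integral>x. \<bar>\<phi> x - f x\<bar> \<partial>M) < e / 2"
    using add.IH(1)[of "e / 2"] add.prems by auto
  obtain \<psi> where \<psi>: "continuous_on UNIV \<psi>" "(\<integral>x. \<bar>\<psi> x - g x\<bar> \<partial>M) < e / 2"
    using add.IH(2)[of "e / 2"] add.prems by auto
  note [simp] = add.hyps integrable_continuous_circle[OF \<phi>(1) assms(2,3)] integrable_continuous_circle[OF \<psi>(1) assms(2,3)]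
  have "(\<integral>x. \<bar>(\<phi> x + \<psi> x) - (f x + g x)\<bar> \<partial>M) \<le> (\<integral>x. \<bar>\<phi> x - f x\<bar> + \<bar>\<psi> x - g x\<bar> \<partial>M)"
    by (intro integral_mono) auto
  also have "\<dots> = (\<integral>x. \<bar>\<phi> x - f x\<bar> \<partial>M) + (\<integral>x. \<bar>\<psi> x - g x\<bar> \<partial>M)"
    by (intro Bochner_Integration.integral_add) auto
  also have "\<dots> < e"
    using \<phi> \<psi> by simp
  finally show ?case
    using \<phi>(1) \<psi>(1) by (intro exI[of _ "\<lambda>x. \<phi> x + \<psi> x"]) (auto intro!: continuous_intros)
next
  case (lim f s)
  have [simp]: "integrable M f" "integrable M (s n)" for n
    using lim.hyps by auto
  have "(\<lambda>n. \<integral>x. \<bar>s n x - f x\<bar> \<partial>M) \<longlonglongrightarrow> (\<integral>x. 0 \<partial>M)"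
  proof (rule integral_dominated_convergence[where w="\<lambda>x. 3 * \<bar>f x\<bar>"])
    have "(\<lambda>n. \<bar>s n x - f x\<bar>) \<longlonglongrightarrow> 0" if "x \<in> space M" for x
      using tendsto_rabs[OF tendsto_diff[OF lim.hyps(2)[OF that] tendsto_const[of "f x"]]] by simp
    then show "AE x in M. (\<lambda>n. \<bar>s n x - f x\<bar>) \<longlonglongrightarrow> 0"
      by (intro AE_I2)
    show "AE x in M. norm \<bar>s n x - f x\<bar> \<le> 3 * \<bar>f x\<bar>" for n
    proof (intro AE_I2)
      fix x assume "x \<in> space M"
      from lim.hyps(3)[OF this, of n] show "norm \<bar>s n x - f x\<bar> \<le> 3 * \<bar>f x\<bar>"
        by simp
    qed
    show "(\<lambda>x. \<bar>s n x - f x\<bar>) \<in> borel_measurable M" for n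
      by (intro borel_measurable_integrable) simp
  qed auto
  then have "eventually (\<lambda>n. (\<integral>x. \<bar>s n x - f x\<bar> \<partial>M) < e / 2) sequentially"
    using lim.prems by (intro order_tendstoD(2)[where y=0]) auto
  then obtain n where n: "(\<integral>x. \<bar>s n x - f x\<bar> \<partial>M) < e / 2"
    using eventually_happens' sequentially_bot by blast
  obtain \<phi> where \<phi>: "continuous_on UNIV \<phi>" "(\<integral>x. \<bar>\<phi> x - s n x\<bar> \<partial>M) < e / 2"
    using lim.IH[of "e / 2" n] lim.prems by auto
  note [simp] = integrable_continuous_circle[OF \<phi>(1) assms(2,3)]
  have "(\<integral>x. \<bar>\<phi> x - f x\<bar> \<partial>M) \<le> (\<integral>x. \<bar>\<phi> x - s n x\<bar> + \<bar>s n x - f x\<bar> \<partial>M)"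
    by (intro integral_mono) auto
  also have "\<dots> = (\<integral>x. \<bar>\<phi> x - s n x\<bar> \<partial>M) + (\<integral>x. \<bar>s n x - f x\<bar> \<partial>M)"
    by (intro Bochner_Integration.integral_add) auto
  also have "\<dots> < e"
    using \<phi> n by simp
  finally show ?case
    using \<phi>(1) by blast
qed

text \<open>Clamping the approximants into the essential range of the density only decreases their
  distance to it; it is what makes the supremum of the resulting weights no larger than the
  essential supremum of the density.\<close>

lemma continuous_approx_integrable:
  fixes \<rho> :: "circle \<Rightarrow> real" and C :: ereal
  assumes \<rho>: "integrable M \<rho>" and M: "finite_measure M" "sets M = sets borel" and "e > 0"
    and "0 \<le> C" and AE: "AE x in M. 0 \<le> \<rho> x" "AE x in M. ereal (\<rho> x) \<le> C"
  obtains \<phi> where "continuous_on UNIV \<phi>" "\<And>x. 0 \<le> \<phi> x" "\<And>x. ereal (\<phi> x) \<le> C"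
    "(\<integral>x. \<bar>\<phi> x - \<rho> x\<bar> \<partial>M) < e"
proof -
  obtain \<psi> where \<psi>: "continuous_on UNIV \<psi>" "(\<integral>x. \<bar>\<psi> x - \<rho> x\<bar> \<partial>M) < e"
    using continuous_approx_integrable_aux[OF \<rho> M \<open>e > 0\<close>] by blast
  define \<phi> where "\<phi> x = (if C = \<infinity> then max 0 (\<psi> x) else max 0 (min (real_of_ereal C) (\<psi> x)))" for x
  have \<phi>: "continuous_on UNIV \<phi>"
    unfolding \<phi>_def by (cases "C = \<infinity>") (auto intro!: continuous_intros \<psi>)
  have bd: "0 \<le> \<phi> x" "ereal (\<phi> x) \<le> C" for x
    using \<open>0 \<le> C\<close> by (cases C; auto simp: \<phi>_def max_def min_def)+
  have "(\<integral>x. \<bar>\<phi> x - \<rho> x\<bar> \<partial>M) \<le> (\<integral>x. \<bar>\<psi> x - \<rho> x\<bar> \<partial>M)"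
  proof (intro integral_mono_AE integrable_abs Bochner_Integration.integrable_diff \<rho> integrable_continuous_circle M \<phi> \<psi>(1))
    show "AE x in M. \<bar>\<phi> x - \<rho> x\<bar> \<le> \<bar>\<psi> x - \<rho> x\<bar>"
      using AE
    proof eventually_elim
      case (elim x)
      then show ?case
        using \<open>0 \<le> C\<close> by (cases C) (auto simp: \<phi>_def max_def min_def)
    qed
  qed
  with \<psi>(2) show ?thesis
    using that[of \<phi>] \<phi> bd by simp
qed

section \<open>Weak limits of discrete measures on the circle\<close>

text \<open>A continuous function close to the indicator of a Borel set for both candidate limits has
  the same integral for both. Uniqueness makes the description of weak limits by \<open>THE\<close> meaningful.\<close>

lemma has_weak_limit_unique:
  assumes "has_weak_limit M \<mu>" "has_weak_limit M \<nu>"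
  shows "\<mu> = \<nu>"
proof -
  have \<mu>: "prob_space \<mu>" "sets \<mu> = sets borel" and \<nu>: "prob_space \<nu>" "sets \<nu> = sets borel"
    using assms by (auto simp: has_weak_limit_def)
  interpret \<mu>: prob_space \<mu> by fact
  interpret \<nu>: prob_space \<nu> by fact
  have eq: "(\<integral>x. f x \<partial>\<mu>) = (\<integral>x. f x \<partial>\<nu>)" if "continuous_on UNIV f" for f :: "circle \<Rightarrow> real"
    using assms that by (auto simp: has_weak_limit_def intro: LIMSEQ_unique)
  show ?thesis
  proof (rule measure_eqI)
    fix A assume A: "A \<in> sets \<mu>"
    have "\<bar>measure \<mu> A - measure \<nu> A\<bar> \<le> e" if "e > 0" for e
    proof -
      have "A \<in> sets borel" "e / 2 > 0"
        using A \<mu> that by auto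
      then obtain \<phi> :: "circle \<Rightarrow> real" where "continuous_on UNIV \<phi>"
        "\<bar>(\<integral>x. \<phi> x \<partial>\<mu>) - measure \<mu> A\<bar> < e / 2" "\<bar>(\<integral>x. \<phi> x \<partial>\<nu>) - measure \<nu> A\<bar> < e / 2"
        using continuous_approx_indicator[OF \<mu>.finite_measure_axioms \<mu>(2) \<nu>.finite_measure_axioms \<nu>(2)]
        by metis
      with eq[of \<phi>] show ?thesis
        by linarith
    qed
    then have "measure \<mu> A = measure \<nu> A"
      using field_le_epsilon[of "\<bar>measure \<mu> A - measure \<nu> A\<bar>" 0] by auto
    then show "emeasure \<mu> A = emeasure \<nu> A"
      by (simp add: \<mu>.emeasure_eq_measure \<nu>.emeasure_eq_measure)
  qed (simp add: \<mu> \<nu>)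
qed

lemma weak_limit_eqI: "has_weak_limit M \<mu> \<Longrightarrow> weak_limit M = \<mu>"
  unfolding weak_limit_def by (rule the_equality) (auto intro: has_weak_limit_unique)

text \<open>Lifted to the interval \<open>[0, 1]\<close> the measures are automatically tight, so Helly's selection
  theorem provides a limit along a subsequence; its image on the circle is then the limit of the
  whole sequence.\<close>

lemma weak_limit_exists_lift:
  fixes P :: "nat \<Rightarrow> 'a measure" and X :: "nat \<Rightarrow> 'a \<Rightarrow> real"
  assumes P: "\<And>N. prob_space (P N)" and X [measurable]: "\<And>N. X N \<in> borel_measurable (P N)"
    and X01: "\<And>N \<omega>. 0 \<le> X N \<omega>" "\<And>N \<omega>. X N \<omega> \<le> 1"
    and conv: "\<And>f :: circle \<Rightarrow> real. continuous_on UNIV f \<Longrightarrow>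
      convergent (\<lambda>N. \<integral>\<omega>. f (abs_circle (X N \<omega>)) \<partial>P N)"
  shows "\<exists>\<mu>. sets \<mu> = sets borel \<and> prob_space \<mu> \<and> (\<forall>f :: circle \<Rightarrow> real. continuous_on UNIV f \<longrightarrow>
      (\<lambda>N. \<integral>\<omega>. f (abs_circle (X N \<omega>)) \<partial>P N) \<longlonglongrightarrow> (\<integral>x. f x \<partial>\<mu>))"
proof -
  define D where "D N = distr (P N) borel (X N)" for N
  have rd: "real_distribution (D N)" for N
    unfolding D_def using P X by (rule prob_space.real_distribution_distr)
  have "tight D"
    unfolding tight_def
  proof (intro conjI allI impI rd)
    fix e :: real assume "e > 0"
    have "measure (D N) {-1<..2} = 1" for N
    proof -
      interpret prob_space "P N" by (rule P)
      have "X N \<omega> \<in> {-1<..2}" for \<omega>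
        using X01[of N \<omega>] by simp
      then have "X N -` {-1<..2} \<inter> space (P N) = space (P N)"
        by blast
      then show ?thesis
        unfolding D_def by (simp add: measure_distr prob_space)
    qed
    then show "\<exists>a b. a < b \<and> (\<forall>N. measure (D N) {a<..b} > 1 - e)"
      using \<open>e > 0\<close> by (intro exI[of _ "-1"] exI[of _ 2]) auto
  qed
  then obtain s M where s: "strict_mono (s :: nat \<Rightarrow> nat)" and M: "real_distribution M"
    and w: "weak_conv_m (D \<circ> id \<circ> s) M"
    using tight_imp_convergent_subsubsequence[of D id] by (auto simp: strict_mono_id)
  interpret M: real_distribution M by (rule M)
  define \<mu> where "\<mu> = distr M borel abs_circle"
  have [measurable]: "abs_circle \<in> M \<rightarrow>\<^sub>M borel"
    using abs_circle_measurable by (simp cong: measurable_cong_sets)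
  have "prob_space \<mu>" "sets \<mu> = sets borel"
    by (auto simp: \<mu>_def intro: M.prob_space_distr)
  moreover have "(\<lambda>N. \<integral>\<omega>. f (abs_circle (X N \<omega>)) \<partial>P N) \<longlonglongrightarrow> (\<integral>x. f x \<partial>\<mu>)"
    if f: "continuous_on UNIV f" for f :: "circle \<Rightarrow> real"
  proof -
    obtain B where B: "\<And>x. \<bar>f x\<bar> \<le> B"
      using continuous_circle_bounded[OF f] by metis
    have [measurable]: "f \<in> borel_measurable borel"
      using f by (rule borel_measurable_continuous_onI)
    have c: "continuous_on UNIV (\<lambda>x. f (abs_circle x))"
      by (rule continuous_on_compose2[OF f continuous_on_abs_circle]) simp
    have "(\<lambda>n. \<integral>x. f (abs_circle x) \<partial>((D \<circ> id \<circ> s) n)) \<longlonglongrightarrow> (\<integral>x. f (abs_circle x) \<partial>M)"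
    proof (rule weak_conv_imp_integral_bdd_continuous_conv[OF _ M w])
      show "real_distribution ((D \<circ> id \<circ> s) n)" for n
        using rd by simp
      show "isCont (\<lambda>x. f (abs_circle x)) x" for x
        using c by (simp add: continuous_on_eq_continuous_at)
      show "norm (f (abs_circle x)) \<le> B" for x
        using B by simp
    qed
    also have "(\<integral>x. f (abs_circle x) \<partial>M) = (\<integral>x. f x \<partial>\<mu>)"
      by (simp add: \<mu>_def integral_distr)
    also have "(\<lambda>n. \<integral>x. f (abs_circle x) \<partial>((D \<circ> id \<circ> s) n)) =
        (\<lambda>N. \<integral>\<omega>. f (abs_circle (X N \<omega>)) \<partial>P N) \<circ> s"
      by (auto simp: D_def integral_distr)
    finally have sub: "((\<lambda>N. \<integral>\<omega>. f (abs_circle (X N \<omega>)) \<partial>P N) \<circ> s) \<longlonglongrightarrow> (\<integral>x. f x \<partial>\<mu>)" .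
    obtain L where L: "(\<lambda>N. \<integral>\<omega>. f (abs_circle (X N \<omega>)) \<partial>P N) \<longlonglongrightarrow> L"
      using conv[OF f] by (auto simp: convergent_def)
    with LIMSEQ_subseq_LIMSEQ[OF L s] sub show ?thesis
      using LIMSEQ_unique by blast
  qed
  ultimately show ?thesis
    by blast
qed

lemma integral_distr_point_measure:
  fixes f :: "circle \<Rightarrow> real"
  assumes "finite A" "\<And>r. r \<in> A \<Longrightarrow> 0 \<le> p r" "continuous_on UNIV f"
  shows "(\<integral>x. f x \<partial>distr (point_measure A (\<lambda>r. ennreal (p r))) borel g) = (\<Sum>r\<in>A. p r * f (g r))"
proof -
  have "f \<in> borel_measurable borel"
    using assms(3) by (rule borel_measurable_continuous_onI)
  then show ?thesis
    using assms by (simp add: integral_distr lebesgue_integral_point_measure_finite)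
qed

lemma weak_limit_exists:
  fixes A :: "nat \<Rightarrow> nat set" and p :: "nat \<Rightarrow> nat \<Rightarrow> real" and g :: "nat \<Rightarrow> circle"
  assumes fin: "\<And>N. finite (A N)" and nn: "\<And>N r. r \<in> A N \<Longrightarrow> 0 \<le> p N r"
    and one: "eventually (\<lambda>N. (\<Sum>r\<in>A N. p N r) = 1) sequentially"
    and conv: "\<And>f :: circle \<Rightarrow> real. continuous_on UNIV f \<Longrightarrow> convergent (\<lambda>N. \<Sum>r\<in>A N. p N r * f (g r))"
  shows "\<exists>\<mu>. has_weak_limit (\<lambda>N. distr (point_measure (A N) (\<lambda>r. ennreal (p N r))) borel g) \<mu>"
proof -
  obtain k where k: "\<And>N. N \<ge> k \<Longrightarrow> (\<Sum>r\<in>A N. p N r) = 1"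
    using one by (auto simp: eventually_sequentially)
  define P where "P N = point_measure (A (N + k)) (\<lambda>r. ennreal (p (N + k) r))" for N
  have "\<exists>x. 0 \<le> x \<and> x \<le> 1 \<and> abs_circle x = g r" for r
  proof (rule circle_cases[of "g r"])
    fix x assume "g r = abs_circle x"
    then show ?thesis
      using frac_ge_0[of x] frac_lt_1[of x] by (intro exI[of _ "frac x"]) (auto simp: abs_circle_frac)
  qed
  then obtain X where X: "\<And>r. 0 \<le> X r" "\<And>r. X r \<le> 1" "\<And>r. abs_circle (X r) = g r"
    by metis
  have int: "(\<integral>r. f (abs_circle (X r)) \<partial>P N) = (\<Sum>r\<in>A (N + k). p (N + k) r * f (g r))"
    for f :: "circle \<Rightarrow> real" and N
    unfolding P_def using fin nn by (simp add: lebesgue_integral_point_measure_finite X)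
  have "\<exists>\<mu>. sets \<mu> = sets borel \<and> prob_space \<mu> \<and> (\<forall>f :: circle \<Rightarrow> real. continuous_on UNIV f \<longrightarrow>
      (\<lambda>N. \<integral>\<omega>. f (abs_circle (X \<omega>)) \<partial>P N) \<longlonglongrightarrow> (\<integral>x. f x \<partial>\<mu>))"
  proof (rule weak_limit_exists_lift)
    show "prob_space (P N)" for N
    proof
      have "emeasure (P N) (space (P N)) = (\<Sum>r\<in>A (N + k). ennreal (p (N + k) r))"
        unfolding P_def using fin by (simp add: emeasure_point_measure_finite space_point_measure)
      also have "\<dots> = ennreal (\<Sum>r\<in>A (N + k). p (N + k) r)"
        using nn by (intro sum_ennreal) auto
      finally show "emeasure (P N) (space (P N)) = 1"
        by (simp add: k)
    qed
    show "X \<in> borel_measurable (P N)" for N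
      by (simp add: P_def)
    show "convergent (\<lambda>N. \<integral>\<omega>. f (abs_circle (X \<omega>)) \<partial>P N)" if "continuous_on UNIV f" for f :: "circle \<Rightarrow> real"
    proof -
      have "convergent (\<lambda>N. \<Sum>r\<in>A (N + k). p (N + k) r * f (g r))"
        using conv[OF that] by (rule convergent_ignore_initial_segment[THEN iffD2])
      then show ?thesis
        by (simp add: int)
    qed
  qed (use X in auto)
  then obtain \<mu> where \<mu>: "sets \<mu> = sets borel" "prob_space \<mu>"
    "\<And>f :: circle \<Rightarrow> real. continuous_on UNIV f \<Longrightarrow>
      (\<lambda>N. \<Sum>r\<in>A (N + k). p (N + k) r * f (g r)) \<longlonglongrightarrow> (\<integral>x. f x \<partial>\<mu>)"
    by (auto simp: int)
  have "(\<lambda>N. \<Sum>r\<in>A N. p N r * f (g r)) \<longlonglongrightarrow> (\<integral>x. f x \<partial>\<mu>)" if "continuous_on UNIV f" for f :: "circle \<Rightarrow> real"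
    using \<mu>(3)[OF that] by (rule LIMSEQ_offset)
  then have "has_weak_limit (\<lambda>N. distr (point_measure (A N) (\<lambda>r. ennreal (p N r))) borel g) \<mu>"
    using \<mu>(1,2) fin nn by (simp add: has_weak_limit_def integral_distr_point_measure)
  then show ?thesis ..
qed

section \<open>Almost periodic sequences\<close>

inductive trig_poly :: "(nat \<Rightarrow> complex) \<Rightarrow> bool" where
  monomial: "trig_poly (\<lambda>r. c * ee (real r * \<theta>))"
| add: "trig_poly p \<Longrightarrow> trig_poly q \<Longrightarrow> trig_poly (\<lambda>r. p r + q r)"

lemma trig_poly_const: "trig_poly (\<lambda>r. c)"
  using trig_poly.monomial[of c 0] by (simp add: ee_def)

lemma trig_poly_mult_monomial: "trig_poly p \<Longrightarrow> trig_poly (\<lambda>r. p r * (c * ee (real r * \<theta>)))"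
proof (induction rule: trig_poly.induct)
  case (monomial d \<eta>)
  have "(\<lambda>r. d * ee (real r * \<eta>) * (c * ee (real r * \<theta>))) = (\<lambda>r. (d * c) * ee (real r * (\<eta> + \<theta>)))"
    by (simp add: distrib_left ee_add mult_ac)
  then show ?case
    using trig_poly.monomial by simp
qed (simp add: distrib_right trig_poly.add)

lemma trig_poly_mult: "trig_poly q \<Longrightarrow> trig_poly p \<Longrightarrow> trig_poly (\<lambda>r. p r * q r)"
  by (induction rule: trig_poly.induct) (simp_all add: trig_poly_mult_monomial distrib_left trig_poly.add)

lemma trig_poly_bounded: "trig_poly p \<Longrightarrow> \<exists>B. \<forall>r. norm (p r) \<le> B"
proof (induction rule: trig_poly.induct)
  case (monomial c \<theta>)
  then show ?case
    by (auto simp: norm_mult)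
next
  case (add p q)
  then obtain B C where "\<And>r. norm (p r) \<le> B" "\<And>r. norm (q r) \<le> C"
    by auto
  then have "norm (p r + q r) \<le> B + C" for r
    by (meson add_mono norm_triangle_le)
  then show ?case by blast
qed

text \<open>The coordinates of \<open>e(x)\<close> are combinations of \<open>e(x)\<close> and \<open>e(-x)\<close>, so polynomials in these coordinates
  are trigonometric polynomials; this is how the Stone--Weierstrass theorem in the plane reaches
  continuous functions on the circle.\<close>

lemma trig_poly_real_polynomial:
  assumes "real_polynomial_function p"
  shows "trig_poly (\<lambda>r. of_real (p (ee (real r * \<theta>))))"
  using assms
proof (induction rule: real_polynomial_function.induct)
  case (linear h)
  define a b where "a = h 1" and "b = h \<i>"
  have h: "h z = Re z * a + Im z * b" for z
  proof -
    interpret bounded_linear h by fact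
    have "z = Re z *\<^sub>R 1 + Im z *\<^sub>R \<i>"
      by (simp add: complex_eq_iff)
    then have "h z = h (Re z *\<^sub>R 1 + Im z *\<^sub>R \<i>)"
      by (rule arg_cong)
    then show ?thesis
      by (simp only: add scaleR a_def b_def) simp
  qed
  have *: "complex_of_real (h (ee x)) = (of_real a - \<i> * of_real b) / 2 * ee x + (of_real a + \<i> * of_real b) / 2 * ee (- x)" for x
    by (simp add: h ee_eq_cis complex_eq_iff field_simps)
  have "(\<lambda>r. complex_of_real (h (ee (real r * \<theta>)))) =
      (\<lambda>r. (of_real a - \<i> * of_real b) / 2 * ee (real r * \<theta>) + (of_real a + \<i> * of_real b) / 2 * ee (real r * (- \<theta>)))"
    by (simp add: *)
  then show ?case
    by (simp only:) (intro trig_poly.intros)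
qed (simp_all add: trig_poly_const trig_poly.add trig_poly_mult)

text \<open>Uniform limits of trigonometric polynomials with arbitrary real frequencies, that is, Bohr's almost
  periodic sequences. Unlike functions of a single \<open>r \<beta>\<close>, they are closed under products of sequences
  with unrelated frequencies \<open>\<alpha>\<close> and \<open>\<beta>\<close>.\<close>

definition almost_periodic :: "(nat \<Rightarrow> real) \<Rightarrow> bool" where
  "almost_periodic f \<longleftrightarrow> (\<forall>e>0. \<exists>p. trig_poly p \<and> (\<forall>r. norm (of_real (f r) - p r) \<le> e))"

lemma almost_periodic_circle:
  fixes f :: "circle \<Rightarrow> real"
  assumes "continuous_on UNIV f"
  shows "almost_periodic (\<lambda>r. f (circle_mult r z))"
  unfolding almost_periodic_def
proof (intro allI impI)
  fix e :: real assume "e > 0"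
  obtain \<theta> where z: "z = abs_circle \<theta>"
    by (rule circle_cases)
  define F where "F = f \<circ> inv circle_exp"
  have "continuous_on (range circle_exp) F"
    unfolding F_def using assms
    by (intro continuous_on_compose continuous_on_inv_circle_exp) (auto intro: continuous_on_subset)
  moreover have "compact (range circle_exp)"
    by (intro compact_continuous_image continuous_on_circle_exp compact_circle)
  ultimately obtain p where p: "real_polynomial_function p" "\<And>u. u \<in> range circle_exp \<Longrightarrow> \<bar>F u - p u\<bar> < e"
    using Stone_Weierstrass_real_polynomial_function \<open>e > 0\<close> by metis
  have "\<bar>f (circle_mult r z) - p (ee (real r * \<theta>))\<bar> < e" for r
    using p(2)[of "circle_exp (circle_mult r z)"]
    by (simp add: z F_def inv_f_f inj_circle_exp circle_mult_abs flip: circle_exp_abs)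
  then show "\<exists>p. trig_poly p \<and> (\<forall>r. norm (of_real (f (circle_mult r z)) - p r) \<le> e)"
    by (intro exI[of _ "\<lambda>r. of_real (p (ee (real r * \<theta>)))"])
       (auto simp: trig_poly_real_polynomial p less_imp_le simp flip: of_real_diff)
qed

lemma almost_periodic_bounded:
  assumes "almost_periodic f"
  obtains B where "B > 0" "\<And>r. \<bar>f r\<bar> \<le> B"
proof -
  obtain p where p: "trig_poly p" "\<And>r. norm (of_real (f r) - p r) \<le> 1"
    using assms by (auto simp: almost_periodic_def intro: zero_less_one)
  obtain C where C: "\<And>r. norm (p r) \<le> C"
    using trig_poly_bounded[OF p(1)] by blast
  have "\<bar>f r\<bar> \<le> C + 1" for r
    using norm_triangle_ineq[of "of_real (f r) - p r" "p r"] p(2)[of r] C[of r] by simp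
  moreover have "C + 1 > 0"
    using C[of 0] norm_ge_zero[of "p 0"] by linarith
  ultimately show ?thesis
    using that by blast
qed

lemma almost_periodic_mult:
  assumes f: "almost_periodic f" and g: "almost_periodic g"
  shows "almost_periodic (\<lambda>r. f r * g r)"
  unfolding almost_periodic_def
proof (intro allI impI)
  fix e :: real assume "e > 0"
  obtain B where B: "B > 0" "\<And>r. \<bar>g r\<bar> \<le> B"
    using almost_periodic_bounded[OF g] by blast
  obtain p where p: "trig_poly p" "\<And>r. norm (of_real (f r) - p r) \<le> e / (2 * B)"
    using f \<open>e > 0\<close> B(1) unfolding almost_periodic_def by (meson divide_pos_pos mult_pos_pos zero_less_numeral)
  obtain C where C: "\<And>r. norm (p r) \<le> C"
    using trig_poly_bounded[OF p(1)] by blast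
  then have "C \<ge> 0"
    using norm_ge_zero order_trans by blast
  then have "e / (2 * (C + 1)) > 0"
    using \<open>e > 0\<close> by simp
  then obtain q where q: "trig_poly q" "\<And>r. norm (of_real (g r) - q r) \<le> e / (2 * (C + 1))"
    using g unfolding almost_periodic_def by blast
  have "norm (of_real (f r * g r) - p r * q r) \<le> e" for r
  proof -
    have "of_real (f r * g r) - p r * q r = (of_real (f r) - p r) * of_real (g r) + p r * (of_real (g r) - q r)"
      by (simp add: algebra_simps)
    also have "norm \<dots> \<le> e / (2 * B) * B + C * (e / (2 * (C + 1)))"
      using p(2)[of r] q(2)[of r] B C[of r] \<open>C \<ge> 0\<close> \<open>e > 0\<close>
      by (intro norm_triangle_mono) (auto simp: norm_mult simp del: times_divide_eq_right times_divide_eq_left intro!: mult_mono)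
    also have "\<dots> \<le> e"
      using B(1) \<open>C \<ge> 0\<close> \<open>e > 0\<close> by (simp add: field_simps)
    finally show ?thesis .
  qed
  then show "\<exists>p. trig_poly p \<and> (\<forall>r. norm (of_real (f r * g r) - p r) \<le> e)"
    using p(1) q(1) trig_poly_mult by (intro exI[of _ "\<lambda>r. p r * q r"]) auto
qed

section \<open>Averages along a good set\<close>

lemma convergent_approx:
  fixes X :: "nat \<Rightarrow> 'a::{complete_space,real_normed_vector}"
  assumes "\<And>e. e > 0 \<Longrightarrow> \<exists>Y. convergent Y \<and> eventually (\<lambda>n. norm (X n - Y n) \<le> e) sequentially"
  shows "convergent X"
proof -
  have "Cauchy X"
  proof (rule metric_CauchyI)
    fix e :: real assume "e > 0"
    then have "e / 4 > 0" by simp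
    then obtain Y k1 where Y: "convergent Y" and k1: "\<And>n. n \<ge> k1 \<Longrightarrow> norm (X n - Y n) \<le> e / 4"
      using assms unfolding eventually_sequentially by meson
    obtain k2 where k2: "\<And>m n. m \<ge> k2 \<Longrightarrow> n \<ge> k2 \<Longrightarrow> dist (Y m) (Y n) < e / 4"
      using metric_CauchyD[OF convergent_Cauchy[OF Y] \<open>e / 4 > 0\<close>] by blast
    have "dist (X m) (X n) < e" if "m \<ge> max k1 k2" "n \<ge> max k1 k2" for m n
    proof -
      have "dist (X m) (X n) \<le> dist (X m) (Y m) + dist (Y m) (Y n) + dist (Y n) (X n)"
        by (meson add_mono dist_triangle dist_triangle_le order_refl order_trans)
      also have "\<dots> < e"
        using k1[of m] k1[of n] k2[of m n] that \<open>e > 0\<close> by (simp add: dist_norm norm_minus_commute)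
      finally show ?thesis .
    qed
    then show "\<exists>M. \<forall>m\<ge>M. \<forall>n\<ge>M. dist (X m) (X n) < e"
      by blast
  qed
  then show ?thesis
    by (rule Cauchy_convergent)
qed

lemma convergent_average_trig_poly:
  assumes "good_set R" "trig_poly p"
  shows "convergent (\<lambda>N. (\<Sum>n<N. p (enumerate R n)) / of_nat N)"
  using assms(2)
proof (induction rule: trig_poly.induct)
  case (monomial c \<theta>)
  have "convergent (\<lambda>N. c * ((\<Sum>n<N. ee (real (enumerate R n) * \<theta>)) / of_nat N))"
    using assms(1) by (intro convergent_mult convergent_const) (auto simp: good_set_def)
  then show ?case
    by (simp add: sum_distrib_left)
next
  case (add p q)
  then show ?case
    using convergent_add[OF add.IH] by (simp add: sum.distrib add_divide_distrib)
qed

lemma convergent_average_enumerate: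
  assumes "good_set R" "almost_periodic f"
  shows "convergent (\<lambda>N. (\<Sum>n<N. f (enumerate R n)) / real N)"
proof -
  have "convergent (\<lambda>N. complex_of_real ((\<Sum>n<N. f (enumerate R n)) / real N))"
  proof (rule convergent_approx)
    fix e :: real assume "e > 0"
    then obtain p where p: "trig_poly p" "\<And>r. norm (of_real (f r) - p r) \<le> e"
      using assms(2) unfolding almost_periodic_def by blast
    have "norm (complex_of_real ((\<Sum>n<N. f (enumerate R n)) / real N) - (\<Sum>n<N. p (enumerate R n)) / of_nat N) \<le> e" for N
    proof (cases "N = 0")
      case False
      have "complex_of_real ((\<Sum>n<N. f (enumerate R n)) / real N) - (\<Sum>n<N. p (enumerate R n)) / of_nat N =
          (\<Sum>n<N. of_real (f (enumerate R n)) - p (enumerate R n)) / of_nat N"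
        by (simp add: sum_subtractf diff_divide_distrib)
      also have "norm \<dots> \<le> (\<Sum>n<N. e) / real N"
        unfolding norm_divide norm_of_nat by (intro divide_right_mono sum_norm_le p) auto
      also have "\<dots> = e"
        using False by simp
      finally show ?thesis .
    qed (use \<open>e > 0\<close> in simp)
    then show "\<exists>Y. convergent Y \<and> eventually (\<lambda>N. norm (complex_of_real ((\<Sum>n<N. f (enumerate R n)) / real N) - Y N) \<le> e) sequentially"
      using convergent_average_trig_poly[OF assms(1) p(1)] by (intro exI conjI) auto
  qed
  then obtain L where "(\<lambda>N. complex_of_real ((\<Sum>n<N. f (enumerate R n)) / real N)) \<longlonglongrightarrow> L"
    by (auto simp: convergent_def)
  from tendsto_Re[OF this] show ?thesis
    by (auto simp: convergent_def simp del: of_real_divide of_real_sum)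
qed

definition average :: "nat set \<Rightarrow> (nat \<Rightarrow> real) \<Rightarrow> nat \<Rightarrow> real" where
  "average R f N = (\<Sum>r\<in>initial_segment R N. f r) / real (card (initial_segment R N))"

lemma finite_initial_segment [simp]: "finite (initial_segment R N)"
  by (simp add: initial_segment_def)

lemma initial_segment_enumerate:
  assumes "good_set R"
  obtains m where "initial_segment R N = enumerate R ` {..<m}"
proof -
  have R: "infinite R" "0 \<notin> R"
    using assms by (auto simp: good_set_def)
  define m where "m = (LEAST n. N < enumerate R n)"
  have "N < enumerate R (Suc N)"
    using R le_enumerate[of R "Suc N"] by simp
  then have m: "N < enumerate R m"
    unfolding m_def by (rule LeastI)
  have "enumerate R n \<le> N \<longleftrightarrow> n < m" for n
  proof
    assume "enumerate R n \<le> N"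
    with m show "n < m"
      using R enumerate_mono_le_iff[of R m n] by (meson leI le_less_trans not_less)
  next
    assume "n < m"
    then show "enumerate R n \<le> N"
      unfolding m_def using not_less_Least by (meson not_less)
  qed
  then have "enumerate R ` {..<m} = {r \<in> range (enumerate R). r \<le> N}"
    by auto
  also have "\<dots> = {r \<in> R. r \<le> N}"
    using R by (simp add: range_enumerate)
  also have "\<dots> = initial_segment R N"
    using R by (auto simp: initial_segment_def Suc_le_eq intro!: gr0I)
  finally have "initial_segment R N = enumerate R ` {..<m}" ..
  then show ?thesis
    using that by blast
qed

text \<open>Good sets are defined by averages over the first \<open>N\<close> elements, weights by averages over the
  elements up to \<open>N\<close>; the latter are the former along the index sequence \<open>card (R \<inter> {1..N})\<close>.\<close>

lemma average_enumerate:
  assumes "good_set R"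
  shows "average R f N = (\<Sum>n<card (initial_segment R N). f (enumerate R n)) / real (card (initial_segment R N))"
proof -
  obtain m where m: "initial_segment R N = enumerate R ` {..<m}"
    using initial_segment_enumerate[OF assms] by metis
  have inj: "inj_on (enumerate R) {..<m}"
    using assms by (auto simp: good_set_def intro: inj_on_subset inj_enumerate)
  then have "card (initial_segment R N) = m"
    by (simp add: m card_image)
  then show ?thesis
    using inj by (simp add: average_def m sum.reindex)
qed

lemma card_initial_segment_at_top:
  assumes "good_set R"
  shows "filterlim (\<lambda>N. card (initial_segment R N)) at_top sequentially"
  unfolding filterlim_at_top
proof
  fix k
  have R: "infinite R" "0 \<notin> R"
    using assms by (auto simp: good_set_def)
  have "k \<le> card (initial_segment R N)" if N: "N \<ge> enumerate R k" for N
  proof -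
    have "enumerate R ` {..<k} \<subseteq> initial_segment R N"
    proof
      fix r assume "r \<in> enumerate R ` {..<k}"
      then obtain n where n: "n < k" "r = enumerate R n"
        by auto
      have "r \<in> R"
        using n R by (simp add: enumerate_in_set)
      moreover have "r \<le> N"
        using n N enumerate_mono[OF n(1) R(1)] by linarith
      ultimately show "r \<in> initial_segment R N"
        using R by (auto simp: initial_segment_def Suc_le_eq intro!: gr0I)
    qed
    then have "card (enumerate R ` {..<k}) \<le> card (initial_segment R N)"
      by (intro card_mono) auto
    moreover have "inj_on (enumerate R) {..<k}"
      using R by (auto intro: inj_on_subset inj_enumerate)
    ultimately show ?thesis
      by (simp add: card_image)
  qed
  then show "eventually (\<lambda>N. k \<le> card (initial_segment R N)) sequentially"
    by (auto simp: eventually_sequentially)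
qed

lemma convergent_average:
  assumes "good_set R" "almost_periodic f"
  shows "convergent (average R f)"
proof -
  obtain L where "(\<lambda>N. (\<Sum>n<N. f (enumerate R n)) / real N) \<longlonglongrightarrow> L"
    using convergent_average_enumerate[OF assms] by (auto simp: convergent_def)
  from filterlim_compose[OF this card_initial_segment_at_top[OF assms(1)]]
  have "average R f \<longlonglongrightarrow> L"
    by (simp add: average_enumerate[OF assms(1), abs_def])
  then show ?thesis
    by (auto simp: convergent_def)
qed

lemma empirical_measure_eq:
  "empirical_measure R \<beta> N =
    distr (point_measure {..<N} (\<lambda>n. ennreal (1 / real N))) borel (\<lambda>n. circle_mult (enumerate R n) \<beta>)"
  by (simp add: empirical_measure_def uniform_count_measure_def)

lemma limit_measure_good:
  assumes R: "good_set R"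
  shows "prob_space (limit_measure R \<beta>)" "sets (limit_measure R \<beta>) = sets borel"
    "\<And>f :: circle \<Rightarrow> real. continuous_on UNIV f \<Longrightarrow>
       average R (\<lambda>r. f (circle_mult r \<beta>)) \<longlonglongrightarrow> (\<integral>x. f x \<partial>limit_measure R \<beta>)"
proof -
  have "\<exists>\<mu>. has_weak_limit (empirical_measure R \<beta>) \<mu>"
    unfolding empirical_measure_eq[abs_def]
  proof (rule weak_limit_exists)
    show "eventually (\<lambda>N. (\<Sum>r<N. 1 / real N) = 1) sequentially"
      by (intro eventually_sequentiallyI[of 1]) auto
    show "convergent (\<lambda>N. \<Sum>r<N. 1 / real N * f (circle_mult (enumerate R r) \<beta>))"
      if "continuous_on UNIV f" for f :: "circle \<Rightarrow> real"
      using convergent_average_enumerate[OF R almost_periodic_circle[OF that, of \<beta>]]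
      by (simp add: sum_divide_distrib)
  qed auto
  then obtain \<mu> where \<mu>: "has_weak_limit (empirical_measure R \<beta>) \<mu>" ..
  then have eq: "limit_measure R \<beta> = \<mu>"
    by (simp add: limit_measure_def weak_limit_eqI)
  show "prob_space (limit_measure R \<beta>)" "sets (limit_measure R \<beta>) = sets borel"
    using \<mu> by (auto simp: eq has_weak_limit_def)
  fix f :: "circle \<Rightarrow> real" assume f: "continuous_on UNIV f"
  have "(\<lambda>N. (\<Sum>n<N. f (circle_mult (enumerate R n) \<beta>)) / real N) \<longlonglongrightarrow> (\<integral>x. f x \<partial>\<mu>)"
    using \<mu> f by (auto simp: has_weak_limit_def empirical_measure_eq integral_distr_point_measure sum_divide_distrib)
  from filterlim_compose[OF this card_initial_segment_at_top[OF R]]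
  show "average R (\<lambda>r. f (circle_mult r \<beta>)) \<longlonglongrightarrow> (\<integral>x. f x \<partial>limit_measure R \<beta>)"
    by (simp add: average_enumerate[OF R, abs_def] eq)
qed

lemma average_mono: "(\<And>r. r \<in> R \<Longrightarrow> f r \<le> g r) \<Longrightarrow> average R f N \<le> average R g N"
  unfolding average_def by (intro divide_right_mono sum_mono) (auto simp: initial_segment_def)

lemma average_add: "average R (\<lambda>r. f r + g r) N = average R f N + average R g N"
  by (simp add: average_def sum.distrib add_divide_distrib)

lemma average_cmult: "average R (\<lambda>r. c * f r) N = c * average R f N"
  by (simp add: average_def sum_distrib_left)

lemma average_abs_diff: "\<bar>average R f N - average R g N\<bar> \<le> average R (\<lambda>r. \<bar>f r - g r\<bar>) N"
proof -
  have "average R f N - average R g N = average R (\<lambda>r. f r - g r) N"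
    by (simp add: average_def sum_subtractf diff_divide_distrib)
  also have "\<bar>\<dots>\<bar> \<le> average R (\<lambda>r. \<bar>f r - g r\<bar>) N"
    unfolding average_def by (simp add: divide_right_mono sum_abs)
  finally show ?thesis .
qed

text \<open>Averages against a bounded sequence are continuous in the averaged seminorm.\<close>

lemma average_abs_diff_mult:
  assumes "\<And>r. \<bar>h r\<bar> \<le> B"
  shows "\<bar>average R (\<lambda>r. f r * h r) N - average R (\<lambda>r. g r * h r) N\<bar> \<le> B * average R (\<lambda>r. \<bar>f r - g r\<bar>) N"
proof -
  have "\<bar>f r * h r - g r * h r\<bar> \<le> B * \<bar>f r - g r\<bar>" for r
    using mult_right_mono[OF assms[of r], of "\<bar>f r - g r\<bar>"] by (simp add: abs_mult mult.commute flip: left_diff_distrib)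
  then have "average R (\<lambda>r. \<bar>f r * h r - g r * h r\<bar>) N \<le> B * average R (\<lambda>r. \<bar>f r - g r\<bar>) N"
    unfolding average_cmult[symmetric] by (intro average_mono)
  with average_abs_diff show ?thesis
    by (rule order_trans)
qed

lemma has_mean_iff: "has_mean R f m \<longleftrightarrow> average R f \<longlonglongrightarrow> m" for f :: "nat \<Rightarrow> real"
  by (simp add: has_mean_def average_def[abs_def] divide_inverse mult.commute)

lemma seminorm1_eq: "seminorm1 R f = limsup (\<lambda>N. ereal (average R (\<lambda>r. \<bar>f r\<bar>) N))" for f :: "nat \<Rightarrow> real"
  by (simp add: seminorm1_def average_def)

lemma sum_normalized_weights:
  "(\<Sum>r\<in>initial_segment R N. w r / (\<Sum>s\<in>initial_segment R N. w s) * h r) =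
    average R (\<lambda>r. w r * h r) N / average R w N"
proof -
  have "(\<Sum>r\<in>initial_segment R N. w r / (\<Sum>s\<in>initial_segment R N. w s) * h r) =
      (\<Sum>r\<in>initial_segment R N. w r * h r) / (\<Sum>s\<in>initial_segment R N. w s)"
    by (simp add: sum_divide_distrib)
  also have "\<dots> = average R (\<lambda>r. w r * h r) N / average R w N"
    by (cases "card (initial_segment R N) = 0") (simp_all add: average_def)
  finally show ?thesis .
qed

lemma integral_weighted_measure:
  fixes f :: "circle \<Rightarrow> real"
  assumes w: "\<And>r. r \<in> R \<Longrightarrow> 0 \<le> w r" and f: "continuous_on UNIV f"
  shows "(\<integral>x. f x \<partial>weighted_measure R w \<beta> N) = average R (\<lambda>r. w r * f (circle_mult r \<beta>)) N / average R w N"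
proof -
  have "(\<integral>x. f x \<partial>weighted_measure R w \<beta> N) =
      (\<Sum>r\<in>initial_segment R N. w r / (\<Sum>s\<in>initial_segment R N. w s) * f (circle_mult r \<beta>))"
    unfolding weighted_measure_def using w f
    by (intro integral_distr_point_measure) (auto intro!: divide_nonneg_nonneg sum_nonneg simp: initial_segment_def)
  then show ?thesis
    by (simp only: sum_normalized_weights)
qed

text \<open>With a positive mean, normalizing by \<open>w(R(N))\<close> and by \<open>#R(N)\<close> are equivalent, so convergence of all
  averages suffices for goodness.\<close>

lemma good_weightI:
  assumes R: "good_set R" and w: "\<And>r. r \<in> R \<Longrightarrow> 0 \<le> w r"
    and m: "average R w \<longlonglongrightarrow> m" "m > 0"
    and conv: "\<And>\<beta> f :: circle \<Rightarrow> real. continuous_on UNIV f \<Longrightarrow> convergent (average R (\<lambda>r. w r * f (circle_mult r \<beta>)))"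
  shows "good_weight R w"
proof -
  have card: "filterlim (\<lambda>N. real (card (initial_segment R N))) at_top sequentially"
    using filterlim_compose[OF filterlim_real_sequentially card_initial_segment_at_top[OF R]] .
  have "(\<Sum>r\<in>initial_segment R N. w r) = average R w N * real (card (initial_segment R N))" for N
    by (auto simp: average_def)
  with filterlim_tendsto_pos_mult_at_top[OF m card]
  have sum: "filterlim (\<lambda>N. \<Sum>r\<in>initial_segment R N. w r) at_top sequentially"
    by simp
  have "\<exists>\<mu>. has_weak_limit (weighted_measure R w \<beta>) \<mu>" for \<beta>
    unfolding weighted_measure_def
  proof (rule weak_limit_exists)
    have "eventually (\<lambda>N. (\<Sum>r\<in>initial_segment R N. w r) > 0) sequentially"
      using sum by (simp add: filterlim_at_top_dense)
    then show "eventually (\<lambda>N. (\<Sum>r\<in>initial_segment R N. w r / (\<Sum>s\<in>initial_segment R N. w s)) = 1) sequentially"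
      by eventually_elim (simp flip: sum_divide_distrib)
    show "0 \<le> w r / (\<Sum>s\<in>initial_segment R N. w s)" if "r \<in> initial_segment R N" for r N
      using w that by (intro divide_nonneg_nonneg sum_nonneg) (auto simp: initial_segment_def)
    show "convergent (\<lambda>N. \<Sum>r\<in>initial_segment R N. w r / (\<Sum>s\<in>initial_segment R N. w s) * f (circle_mult r \<beta>))"
      if f: "continuous_on UNIV f" for f :: "circle \<Rightarrow> real"
    proof -
      obtain L where "average R (\<lambda>r. w r * f (circle_mult r \<beta>)) \<longlonglongrightarrow> L"
        using conv[OF f] by (auto simp: convergent_def)
      then have "(\<lambda>N. average R (\<lambda>r. w r * f (circle_mult r \<beta>)) N / average R w N) \<longlonglongrightarrow> L / m"
        using m by (intro tendsto_divide) auto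
      then show ?thesis
        unfolding sum_normalized_weights by (auto simp: convergent_def)
    qed
  qed simp
  then show ?thesis
    using w sum by (auto simp: good_weight_def is_weight_def)
qed

lemma has_weak_limit_weight_limit_measure:
  "good_weight R w \<Longrightarrow> has_weak_limit (weighted_measure R w \<beta>) (weight_limit_measure R w \<beta>)"
  unfolding good_weight_def weight_limit_measure_def by (metis weak_limit_eqI)

section \<open>Completeness of the averaged seminorm\<close>

lemma sum_half_powers_le: "(\<Sum>l\<in>{i..<N}. (1/2) ^ l) \<le> 2 * (1/2::real) ^ i"
proof (cases "i \<le> N")
  case True
  then have "(\<Sum>l\<in>{i..<N}. (1/2) ^ l) = 2 * (1/2::real) ^ i - 2 * (1/2) ^ N"
    by (induction N rule: dec_induct) auto
  then show ?thesis
    by simp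
qed simp

lemma abs_diff_le_sum_abs_diff:
  fixes a :: "nat \<Rightarrow> real"
  assumes "i \<le> j"
  shows "\<bar>a j - a i\<bar> \<le> (\<Sum>l\<in>{i..<j}. \<bar>a (Suc l) - a l\<bar>)"
  using assms by (induction j rule: dec_induct) auto

text \<open>The limit of a fast Cauchy sequence is built by switching from one term of the sequence to the next
  at sufficiently late times. A difference of consecutive terms only enters the averages past its switching
  time, where its averages are already within the geometric bound, and so the errors add up
  to a geometric series.\<close>

lemma seminorm_complete:
  fixes v :: "nat \<Rightarrow> nat \<Rightarrow> real"
  assumes R: "good_set R"
    and cauchy: "\<And>m. eventually (\<lambda>N. average R (\<lambda>r. \<bar>v (Suc m) r - v m r\<bar>) N \<le> (1/2) ^ m) sequentially"
  obtains w where "\<And>r. \<exists>m. w r = v m r"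
    "\<And>m. eventually (\<lambda>N. average R (\<lambda>r. \<bar>w r - v m r\<bar>) N \<le> 3 * (1/2) ^ m) sequentially"
proof -
  obtain K where K: "\<And>m N. N \<ge> K m \<Longrightarrow> average R (\<lambda>r. \<bar>v (Suc m) r - v m r\<bar>) N \<le> (1/2) ^ m"
    using cauchy unfolding eventually_sequentially by metis
  \<comment> \<open>\<open>T m\<close> is the time at which the weight switches to \<open>v m\<close>.\<close>
  define T where "T = rec_nat 0 (\<lambda>m t. max (Suc t) (K m))"
  have T: "T 0 = 0" "T (Suc m) = max (Suc (T m)) (K m)" for m
    by (simp_all add: T_def)
  have mono: "strict_mono T"
    by (simp add: strict_mono_Suc_iff T less_max_iff_disj)
  then have ge: "m \<le> T m" for m
    by (rule strict_mono_imp_increasing)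
  define J where "J r = Max {m. T m \<le> r}" for r
  have fin: "finite {m. T m \<le> r}" for r
    by (rule finite_subset[of _ "{..r}"]) (use ge order_trans in auto)
  have TJ: "T (J r) \<le> r" for r
  proof -
    have "0 \<in> {m. T m \<le> r}"
      by (simp add: T)
    then have "J r \<in> {m. T m \<le> r}"
      unfolding J_def using fin by (intro Max_in) auto
    then show ?thesis
      by simp
  qed
  have J_iff: "T l \<le> r \<longleftrightarrow> l \<le> J r" for l r
  proof
    show "l \<le> J r" if "T l \<le> r"
      using that fin by (simp add: J_def Max_ge)
    show "T l \<le> r" if "l \<le> J r"
      using that mono TJ[of r] by (meson order_trans strict_mono_less_eq)
  qed
  define w where "w r = v (J r) r" for r
  define d where "d l r = \<bar>v (Suc l) r - v l r\<bar>" for l r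
  have "eventually (\<lambda>N. average R (\<lambda>r. \<bar>w r - v i r\<bar>) N \<le> 3 * (1/2) ^ i) sequentially" for i
  proof -
    \<comment> \<open>The terms before the switch to \<open>v i\<close> contribute a constant, which the averages forget.\<close>
    define c where "c = (\<Sum>r\<in>{..<T i}. \<bar>w r - v i r\<bar>)"
    have bound: "average R (\<lambda>r. \<bar>w r - v i r\<bar>) N \<le> c / real (card (initial_segment R N)) + 2 * (1/2) ^ i" for N
    proof -
      let ?S = "initial_segment R N"
      have pt: "\<bar>w r - v i r\<bar> \<le> (if r < T i then \<bar>w r - v i r\<bar> else 0) + (\<Sum>l\<in>{i..<N}. if T (Suc l) \<le> r then d l r else 0)"
        if r: "r \<in> ?S" for r
      proof (cases "r < T i")
        case True
        then show ?thesis
          by (simp add: sum_nonneg d_def)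
      next
        case False
        then have "i \<le> J r"
          using J_iff[of i r] by simp
        have "J r \<le> N"
          using ge[of "J r"] TJ[of r] r by (auto simp: initial_segment_def)
        have "\<bar>w r - v i r\<bar> \<le> (\<Sum>l\<in>{i..<J r}. d l r)"
          unfolding w_def d_def using \<open>i \<le> J r\<close> by (rule abs_diff_le_sum_abs_diff)
        also have "\<dots> = (\<Sum>l\<in>{i..<J r}. if T (Suc l) \<le> r then d l r else 0)"
          by (intro sum.cong) (auto simp: J_iff)
        also have "\<dots> \<le> (\<Sum>l\<in>{i..<N}. if T (Suc l) \<le> r then d l r else 0)"
          using \<open>J r \<le> N\<close> by (intro sum_mono2) (auto simp: d_def)
        finally show ?thesis
          using False by simp
      qed
      have early: "(\<Sum>r\<in>?S. if r < T i then \<bar>w r - v i r\<bar> else 0) \<le> c"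
      proof -
        have "(\<Sum>r\<in>?S. if r < T i then \<bar>w r - v i r\<bar> else 0) = (\<Sum>r\<in>?S \<inter> {..<T i}. \<bar>w r - v i r\<bar>)"
          by (simp add: sum.If_cases lessThan_def)
        also have "\<dots> \<le> c"
          unfolding c_def by (intro sum_mono2) auto
        finally show ?thesis .
      qed
      have late: "(\<Sum>r\<in>?S. if T (Suc l) \<le> r then d l r else 0) \<le> real (card ?S) * (1/2) ^ l" for l
      proof (cases "T (Suc l) \<le> N")
        case False
        then have "(\<Sum>r\<in>?S. if T (Suc l) \<le> r then d l r else 0) = 0"
          by (intro sum.neutral) (auto simp: initial_segment_def)
        then show ?thesis
          by simp
      next
        case True
        then have "average R (d l) N \<le> (1/2) ^ l"
          using K[of l N] by (simp add: T d_def[abs_def])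
        then have "(\<Sum>r\<in>?S. d l r) \<le> real (card ?S) * (1/2) ^ l"
          by (cases "card ?S = 0") (auto simp: average_def field_simps)
        moreover have "(\<Sum>r\<in>?S. if T (Suc l) \<le> r then d l r else 0) \<le> (\<Sum>r\<in>?S. d l r)"
          by (intro sum_mono) (auto simp: d_def)
        ultimately show ?thesis
          by linarith
      qed
      have "(\<Sum>r\<in>?S. \<bar>w r - v i r\<bar>) \<le>
          (\<Sum>r\<in>?S. (if r < T i then \<bar>w r - v i r\<bar> else 0) + (\<Sum>l\<in>{i..<N}. if T (Suc l) \<le> r then d l r else 0))"
        by (intro sum_mono pt)
      also have "\<dots> = (\<Sum>r\<in>?S. if r < T i then \<bar>w r - v i r\<bar> else 0) +
          (\<Sum>l\<in>{i..<N}. \<Sum>r\<in>?S. if T (Suc l) \<le> r then d l r else 0)"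
        unfolding sum.distrib by (subst sum.swap) simp
      also have "\<dots> \<le> c + (\<Sum>l\<in>{i..<N}. real (card ?S) * (1/2) ^ l)"
        by (intro add_mono early sum_mono late)
      also have "\<dots> \<le> c + real (card ?S) * (2 * (1/2) ^ i)"
        unfolding sum_distrib_left[symmetric] by (intro add_left_mono mult_left_mono sum_half_powers_le) simp
      finally have "average R (\<lambda>r. \<bar>w r - v i r\<bar>) N \<le> (c + real (card ?S) * (2 * (1/2) ^ i)) / real (card ?S)"
        unfolding average_def by (rule divide_right_mono) simp
      also have "\<dots> \<le> c / real (card ?S) + 2 * (1/2) ^ i"
        by (simp add: add_divide_distrib)
      finally show ?thesis .
    qed
    have "(\<lambda>N. c / real (card (initial_segment R N))) \<longlonglongrightarrow> 0"
      by (intro tendsto_divide_0[OF tendsto_const] filterlim_at_top_imp_at_infinity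
          filterlim_compose[OF filterlim_real_sequentially] card_initial_segment_at_top R)
    then have "eventually (\<lambda>N. c / real (card (initial_segment R N)) < (1/2) ^ i) sequentially"
      by (intro order_tendstoD(2)[where y=0]) auto
    then show ?thesis
    proof eventually_elim
      case (elim N)
      with bound[of N] show ?case
        by simp
    qed
  qed
  then show ?thesis
    using that[of w] w_def by blast
qed

section \<open>Comparing measures through continuous functions\<close>

text \<open>Approximating the indicator of a Borel set simultaneously for both measures.\<close>

lemma measure_le_of_continuous:
  fixes M N :: "circle measure"
  assumes M: "finite_measure M" "sets M = sets borel" and N: "finite_measure N" "sets N = sets borel"
    and "K \<ge> 0" and A: "A \<in> sets borel"
    and le: "\<And>f :: circle \<Rightarrow> real. continuous_on UNIV f \<Longrightarrow> (\<And>x. 0 \<le> f x) \<Longrightarrow> (\<And>x. f x \<le> 1) \<Longrightarrow>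
      (\<integral>x. f x \<partial>N) \<le> K * (\<integral>x. f x \<partial>M) + c"
  shows "measure N A \<le> K * measure M A + c"
proof (rule field_le_epsilon)
  fix e :: real assume "e > 0"
  define d where "d = e / (K + 1)"
  have "d > 0"
    using \<open>e > 0\<close> \<open>K \<ge> 0\<close> by (simp add: d_def)
  then obtain f :: "circle \<Rightarrow> real" where f: "continuous_on UNIV f" "\<And>x. 0 \<le> f x" "\<And>x. f x \<le> 1"
    "\<bar>(\<integral>x. f x \<partial>M) - measure M A\<bar> < d" "\<bar>(\<integral>x. f x \<partial>N) - measure N A\<bar> < d"
    using continuous_approx_indicator[OF M N A] by metis
  have "measure N A \<le> (\<integral>x. f x \<partial>N) + d"
    using f(5) by linarith
  also have "\<dots> \<le> K * (\<integral>x. f x \<partial>M) + c + d"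
    using le[OF f(1-3)] by simp
  also have "\<dots> \<le> K * (measure M A + d) + c + d"
    using f(4) \<open>K \<ge> 0\<close> by (intro add_right_mono mult_left_mono) auto
  also have "\<dots> = K * measure M A + c + (K + 1) * d"
    by (simp add: algebra_simps)
  also have "(K + 1) * d = e"
    using \<open>K \<ge> 0\<close> by (simp add: d_def)
  finally show "measure N A \<le> K * measure M A + c + e" .
qed

section \<open>Representing densities by weights\<close>

lemma has_weak_limit_density:
  fixes \<rho> :: "circle \<Rightarrow> real"
  assumes M: "sets M = sets borel" and w: "\<And>r. r \<in> R \<Longrightarrow> 0 \<le> w r"
    and \<rho>: "integrable M \<rho>" "AE x in M. 0 \<le> \<rho> x" "(\<integral>x. \<rho> x \<partial>M) = 1"
    and lim: "\<And>f :: circle \<Rightarrow> real. continuous_on UNIV f \<Longrightarrow>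
      average R (\<lambda>r. w r * f (circle_mult r \<alpha>)) \<longlonglongrightarrow> (\<integral>x. \<rho> x * f x \<partial>M)"
  shows "has_weak_limit (weighted_measure R w \<alpha>) (density M (\<lambda>x. ennreal (\<rho> x)))"
proof -
  have [measurable]: "\<rho> \<in> borel_measurable M"
    using \<rho> by simp
  have one: "average R w \<longlonglongrightarrow> 1"
    using lim[of "\<lambda>x. 1"] \<rho> by simp
  have "prob_space (density M (\<lambda>x. ennreal (\<rho> x)))"
  proof
    have "(\<integral>\<^sup>+ x. ennreal (\<rho> x) \<partial>M) = ennreal (\<integral>x. \<rho> x \<partial>M)"
      using \<rho> by (intro nn_integral_eq_integral)
    then show "emeasure (density M (\<lambda>x. ennreal (\<rho> x))) (space (density M (\<lambda>x. ennreal (\<rho> x)))) = 1"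
      using \<rho> by (simp add: emeasure_density cong: nn_integral_cong)
  qed
  moreover have "(\<lambda>N. \<integral>x. f x \<partial>weighted_measure R w \<alpha> N) \<longlonglongrightarrow> (\<integral>x. f x \<partial>density M (\<lambda>x. ennreal (\<rho> x)))"
    if f: "continuous_on UNIV f" for f :: "circle \<Rightarrow> real"
  proof -
    have "f \<in> borel_measurable M"
      using borel_measurable_continuous_onI[OF f] M by (simp cong: measurable_cong_sets)
    then have "(\<integral>x. f x \<partial>density M (\<lambda>x. ennreal (\<rho> x))) = (\<integral>x. \<rho> x * f x \<partial>M)"
      using \<rho> by (subst integral_density) auto
    with tendsto_divide[OF lim[OF f] one] w f show ?thesis
      by (simp add: integral_weighted_measure)
  qed
  ultimately show ?thesis
    using M by (simp add: has_weak_limit_def)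
qed

text \<open>The weight is the limit of \<open>\<phi>\<^sub>m(r \<alpha>)\<close> for continuous \<open>\<phi>\<^sub>m\<close> converging to the density. Every value of the
  weight is a value of some \<open>\<phi>\<^sub>m\<close>, which is why a bound for the density carries over.\<close>

lemma representing_weight_exists:
  fixes \<rho> :: "circle \<Rightarrow> real" and C :: ereal
  assumes R: "good_set R" and M_def: "M = limit_measure R \<alpha>"
    and \<rho>: "integrable M \<rho>" "AE x in M. 0 \<le> \<rho> x" "(\<integral>x. \<rho> x \<partial>M) = 1"
    and C: "0 \<le> C" "AE x in M. ereal (\<rho> x) \<le> C"
  obtains w where "integrable_weight R w" "good_weight R w" "\<And>r. 0 \<le> w r" "\<And>r. ereal (w r) \<le> C"
    "\<And>f :: circle \<Rightarrow> real. continuous_on UNIV f \<Longrightarrow>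
       average R (\<lambda>r. w r * f (circle_mult r \<alpha>)) \<longlonglongrightarrow> (\<integral>x. \<rho> x * f x \<partial>M)"
proof -
  have M: "prob_space M" "sets M = sets borel"
    using limit_measure_good[OF R] by (auto simp: M_def)
  interpret prob_space M by fact
  \<comment> \<open>The factor \<open>1/4\<close> keeps the mean of every approximant positive, so that each is a good weight.\<close>
  have "\<exists>\<phi>. continuous_on UNIV \<phi> \<and> (\<forall>x. 0 \<le> \<phi> x) \<and> (\<forall>x. ereal (\<phi> x) \<le> C) \<and>
      (\<integral>x. \<bar>\<phi> x - \<rho> x\<bar> \<partial>M) < (1/4) * (1/2) ^ m" for m :: nat
    using continuous_approx_integrable[OF \<rho>(1) finite_measure_axioms M(2) _ C(1) \<rho>(2) C(2), of "(1/4) * (1/2) ^ m"]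
    by (metis mult_pos_pos zero_less_divide_1_iff zero_less_numeral zero_less_power)
  then obtain \<phi> :: "nat \<Rightarrow> circle \<Rightarrow> real" where \<phi>: "\<And>m. continuous_on UNIV (\<phi> m)" "\<And>m x. 0 \<le> \<phi> m x"
    "\<And>m x. ereal (\<phi> m x) \<le> C" "\<And>m. (\<integral>x. \<bar>\<phi> m x - \<rho> x\<bar> \<partial>M) < (1/4) * (1/2) ^ m"
    by metis
  have int [simp]: "integrable M f" if "continuous_on UNIV f" for f :: "circle \<Rightarrow> real"
    using integrable_continuous_circle[OF that finite_measure_axioms M(2)] .
  have \<phi>_close: "\<bar>(\<integral>x. \<phi> m x * f x \<partial>M) - (\<integral>x. \<rho> x * f x \<partial>M)\<bar> \<le> B * ((1/4) * (1/2) ^ m)"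
    if f: "continuous_on UNIV f" and B: "\<And>x. \<bar>f x\<bar> \<le> B" for m f B
  proof -
    have "B \<ge> 0"
      using B abs_ge_zero order_trans by blast
    have i1: "integrable M (\<lambda>x. \<phi> m x * f x)"
      using \<phi>(1) f by (intro int continuous_intros)
    have [measurable]: "f \<in> borel_measurable M"
      using int[OF f] by simp
    have i2: "integrable M (\<lambda>x. \<rho> x * f x)"
    proof (rule Bochner_Integration.integrable_bound[OF integrable_mult_right[OF \<rho>(1), of B]])
      show "(\<lambda>x. \<rho> x * f x) \<in> borel_measurable M"
        using \<rho>(1) by measurable
      have "\<bar>\<rho> x\<bar> * \<bar>f x\<bar> \<le> B * \<bar>\<rho> x\<bar>" for x
        using mult_right_mono[OF B[of x], of "\<bar>\<rho> x\<bar>"] by (simp add: mult.commute)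
      then show "AE x in M. norm (\<rho> x * f x) \<le> norm (B * \<rho> x)"
        using \<open>B \<ge> 0\<close> by (simp add: abs_mult)
    qed
    have "(\<integral>x. \<phi> m x * f x \<partial>M) - (\<integral>x. \<rho> x * f x \<partial>M) = (\<integral>x. \<phi> m x * f x - \<rho> x * f x \<partial>M)"
      using i1 i2 by simp
    also have "\<bar>\<dots>\<bar> \<le> (\<integral>x. \<bar>\<phi> m x * f x - \<rho> x * f x\<bar> \<partial>M)"
      by (rule integral_abs_bound)
    also have "\<dots> \<le> (\<integral>x. B * \<bar>\<phi> m x - \<rho> x\<bar> \<partial>M)"
    proof (intro integral_mono integrable_abs Bochner_Integration.integrable_diff i1 i2 integrable_mult_right int[OF \<phi>(1)] \<rho>(1))
      fix x
      have "\<phi> m x * f x - \<rho> x * f x = f x * (\<phi> m x - \<rho> x)"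
        by (simp add: algebra_simps)
      then show "\<bar>\<phi> m x * f x - \<rho> x * f x\<bar> \<le> B * \<bar>\<phi> m x - \<rho> x\<bar>"
        using mult_right_mono[OF B[of x], of "\<bar>\<phi> m x - \<rho> x\<bar>"] by (simp add: abs_mult)
    qed
    also have "\<dots> = B * (\<integral>x. \<bar>\<phi> m x - \<rho> x\<bar> \<partial>M)"
      by simp
    also have "\<dots> \<le> B * ((1/4) * (1/2) ^ m)"
      using \<phi>(4)[of m] \<open>B \<ge> 0\<close> by (intro mult_left_mono) auto
    finally show ?thesis .
  qed
  define v where "v m r = \<phi> m (circle_mult r \<alpha>)" for m r
  have v_mean: "average R (v m) \<longlonglongrightarrow> (\<integral>x. \<phi> m x \<partial>M)" for m
    unfolding v_def[abs_def] M_def by (rule limit_measure_good(3)[OF R \<phi>(1)])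
  have v_pos: "(\<integral>x. \<phi> m x \<partial>M) > 0" for m
  proof -
    have "\<bar>(\<integral>x. \<phi> m x \<partial>M) - 1\<bar> \<le> (1/4) * (1/2) ^ m"
      using \<phi>_close[of "\<lambda>x. 1" 1 m] \<rho>(3) by simp
    moreover have "(1/2) ^ m \<le> (1::real)"
      by (simp add: power_le_one)
    ultimately show ?thesis
      by (simp add: abs_if split: if_splits)
  qed
  have v_conv: "convergent (average R (\<lambda>r. v m r * f (circle_mult r \<beta>)))"
    if "continuous_on UNIV f" for f :: "circle \<Rightarrow> real" and m \<beta>
    unfolding v_def by (intro convergent_average R almost_periodic_mult almost_periodic_circle \<phi>(1) that)
  have v_good: "good_weight R (v m)" for m
    using \<phi>(2) by (intro good_weightI[OF R _ v_mean v_pos v_conv]) (auto simp: v_def)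
  have "eventually (\<lambda>N. average R (\<lambda>r. \<bar>v (Suc m) r - v m r\<bar>) N \<le> (1/2) ^ m) sequentially" for m
  proof -
    have "(\<integral>x. \<bar>\<phi> (Suc m) x - \<phi> m x\<bar> \<partial>M) \<le> (\<integral>x. \<bar>\<phi> (Suc m) x - \<rho> x\<bar> + \<bar>\<phi> m x - \<rho> x\<bar> \<partial>M)"
      using \<phi>(1) \<rho>(1) by (intro integral_mono) auto
    also have "\<dots> = (\<integral>x. \<bar>\<phi> (Suc m) x - \<rho> x\<bar> \<partial>M) + (\<integral>x. \<bar>\<phi> m x - \<rho> x\<bar> \<partial>M)"
      using \<phi>(1) \<rho>(1) by (intro Bochner_Integration.integral_add) auto
    also have "\<dots> < (1/4) * (1/2) ^ Suc m + (1/4) * (1/2) ^ m"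
      by (intro add_strict_mono \<phi>)
    also have "\<dots> \<le> (1/2) ^ m"
      by simp
    finally have less: "(\<integral>x. \<bar>\<phi> (Suc m) x - \<phi> m x\<bar> \<partial>M) < (1/2) ^ m" .
    have "continuous_on UNIV (\<lambda>x. \<bar>\<phi> (Suc m) x - \<phi> m x\<bar>)"
      by (intro continuous_intros \<phi>)
    from limit_measure_good(3)[OF R this, of \<alpha>]
    have "average R (\<lambda>r. \<bar>v (Suc m) r - v m r\<bar>) \<longlonglongrightarrow> (\<integral>x. \<bar>\<phi> (Suc m) x - \<phi> m x\<bar> \<partial>M)"
      by (simp add: v_def M_def)
    from order_tendstoD(2)[OF this less] show ?thesis
      by eventually_elim simp
  qed
  then obtain w where w: "\<And>r. \<exists>m. w r = v m r"
    and w_close: "\<And>m. eventually (\<lambda>N. average R (\<lambda>r. \<bar>w r - v m r\<bar>) N \<le> 3 * (1/2) ^ m) sequentially"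
    using seminorm_complete[OF R, of v] by blast
  have w_bounds: "0 \<le> w r" "ereal (w r) \<le> C" for r
    using w[of r] \<phi>(2,3) by (auto simp: v_def)
  have wf_close: "eventually (\<lambda>N. \<bar>average R (\<lambda>r. w r * f (circle_mult r \<beta>)) N -
      average R (\<lambda>r. v m r * f (circle_mult r \<beta>)) N\<bar> \<le> B * (3 * (1/2) ^ m)) sequentially"
    if B: "\<And>x. \<bar>f x\<bar> \<le> B" for f :: "circle \<Rightarrow> real" and B m \<beta>
    using w_close[of m]
  proof eventually_elim
    case (elim N)
    have "B \<ge> 0"
      using B abs_ge_zero order_trans by blast
    have "\<bar>average R (\<lambda>r. w r * f (circle_mult r \<beta>)) N - average R (\<lambda>r. v m r * f (circle_mult r \<beta>)) N\<bar>
        \<le> B * average R (\<lambda>r. \<bar>w r - v m r\<bar>) N"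
      by (intro average_abs_diff_mult B)
    also have "\<dots> \<le> B * (3 * (1/2) ^ m)"
      using elim \<open>B \<ge> 0\<close> by (rule mult_left_mono)
    finally show ?case .
  qed
  have half: "(\<lambda>m. c * (1/2) ^ m) \<longlonglongrightarrow> 0" for c :: real
    by (intro tendsto_mult_right_zero LIMSEQ_power_zero) simp
  have w_conv: "convergent (average R (\<lambda>r. w r * f (circle_mult r \<beta>)))"
    if f: "continuous_on UNIV f" for f :: "circle \<Rightarrow> real" and \<beta>
  proof (rule convergent_approx)
    fix e :: real assume "e > 0"
    obtain B where B: "\<And>x. \<bar>f x\<bar> \<le> B"
      using continuous_circle_bounded[OF f] by metis
    have "eventually (\<lambda>m. (B * 3) * (1/2) ^ m < e) sequentially"
      using half \<open>e > 0\<close> by (intro order_tendstoD(2)[where y=0])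
    then obtain m where m: "B * (3 * (1/2) ^ m) < e"
      by (auto simp: eventually_sequentially mult.assoc)
    have "eventually (\<lambda>N. norm (average R (\<lambda>r. w r * f (circle_mult r \<beta>)) N -
      average R (\<lambda>r. v m r * f (circle_mult r \<beta>)) N) \<le> e) sequentially"
    proof (rule eventually_mono)
      show "eventually (\<lambda>N. \<bar>average R (\<lambda>r. w r * f (circle_mult r \<beta>)) N -
          average R (\<lambda>r. v m r * f (circle_mult r \<beta>)) N\<bar> \<le> B * (3 * (1/2) ^ m)) sequentially"
        using B by (rule wf_close)
    qed (use m in simp)
    with v_conv[OF f] show "\<exists>Y. convergent Y \<and>
        eventually (\<lambda>N. norm (average R (\<lambda>r. w r * f (circle_mult r \<beta>)) N - Y N) \<le> e) sequentially"
      by blast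
  qed
  have w_lim: "average R (\<lambda>r. w r * f (circle_mult r \<alpha>)) \<longlonglongrightarrow> (\<integral>x. \<rho> x * f x \<partial>M)"
    if f: "continuous_on UNIV f" for f :: "circle \<Rightarrow> real"
  proof -
    obtain B where B: "\<And>x. \<bar>f x\<bar> \<le> B"
      using continuous_circle_bounded[OF f] by metis
    obtain L where L: "average R (\<lambda>r. w r * f (circle_mult r \<alpha>)) \<longlonglongrightarrow> L"
      using w_conv[OF f] by (auto simp: convergent_def)
    have "\<bar>L - (\<integral>x. \<rho> x * f x \<partial>M)\<bar> \<le> (4 * B) * (1/2) ^ m" for m
    proof -
      have "continuous_on UNIV (\<lambda>x. \<phi> m x * f x)"
        by (intro continuous_intros \<phi> f)
      from limit_measure_good(3)[OF R this, of \<alpha>]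
      have "average R (\<lambda>r. v m r * f (circle_mult r \<alpha>)) \<longlonglongrightarrow> (\<integral>x. \<phi> m x * f x \<partial>M)"
        by (simp add: v_def M_def)
      then have "\<bar>L - (\<integral>x. \<phi> m x * f x \<partial>M)\<bar> \<le> B * (3 * (1/2) ^ m)"
        using wf_close[OF B] by (intro tendsto_upperbound[OF tendsto_rabs[OF tendsto_diff[OF L]]]) auto
      moreover have "B \<ge> 0"
        using B abs_ge_zero order_trans by blast
      moreover note \<phi>_close[OF f B, of m]
      ultimately have "\<bar>L - (\<integral>x. \<rho> x * f x \<partial>M)\<bar> \<le> B * (3 * (1/2) ^ m) + B * ((1/4) * (1/2) ^ m)"
        by linarith
      also have "\<dots> \<le> (4 * B) * (1/2) ^ m"
        using \<open>B \<ge> 0\<close> by (simp add: field_simps)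
      finally show ?thesis .
    qed
    then have "\<bar>L - (\<integral>x. \<rho> x * f x \<partial>M)\<bar> \<le> 0"
      by (intro LIMSEQ_le_const[OF half]) auto
    then show ?thesis
      using L by simp
  qed
  have w_good: "good_weight R w"
  proof (rule good_weightI[OF R w_bounds(1) _ zero_less_one w_conv])
    show "average R w \<longlonglongrightarrow> 1"
      using w_lim[of "\<lambda>x. 1"] \<rho>(3) by simp
  qed
  have "integrable_weight R w"
    unfolding integrable_weight_def
  proof (intro conjI allI impI)
    show "is_weight R w"
      using w_good by (simp add: good_weight_def)
    fix e :: real assume "e > 0"
    have "eventually (\<lambda>m. 3 * (1/2) ^ m < e) sequentially"
      using half \<open>e > 0\<close> by (intro order_tendstoD(2)[where y=0])
    then obtain m where m: "3 * (1/2) ^ m < e"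
      by (auto simp: eventually_sequentially)
    obtain B where B: "\<And>x. \<bar>\<phi> m x\<bar> \<le> B"
      using continuous_circle_bounded[OF \<phi>(1)] by metis
    have "sup_norm R (v m) \<le> ereal B"
      unfolding sup_norm_def v_def using B abs_le_D1 by (intro SUP_least) auto
    then have "sup_norm R (v m) < \<infinity>"
      by (rule le_less_trans) simp
    moreover have "seminorm1 R (\<lambda>r. v m r - w r) \<le> ereal (3 * (1/2) ^ m)"
      unfolding seminorm1_eq using w_close[of m] by (intro Limsup_bounded) (simp add: abs_minus_commute)
    then have "seminorm1 R (\<lambda>r. v m r - w r) < ereal e"
      by (rule le_less_trans) (simp add: m)
    ultimately show "\<exists>v. good_weight R v \<and> sup_norm R v < \<infinity> \<and> seminorm1 R (\<lambda>r. v r - w r) < ereal e"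
      using v_good by blast
  qed
  then show ?thesis
    using that w_good w_bounds w_lim by blast
qed

text \<open>The bound passes from the weight to integrals of continuous functions, then to Borel sets, and is
  finally tested on the set where the density exceeds it.\<close>

lemma AE_density_le_of_weight_le:
  fixes \<rho> :: "circle \<Rightarrow> real"
  assumes R: "good_set R" and M_def: "M = limit_measure R \<alpha>"
    and \<rho>: "integrable M \<rho>" "AE x in M. 0 \<le> \<rho> x" "(\<integral>x. \<rho> x \<partial>M) = 1"
    and w: "\<And>r. r \<in> R \<Longrightarrow> 0 \<le> w r" "\<And>r. r \<in> R \<Longrightarrow> w r \<le> s" and "0 \<le> s"
    and lim: "\<And>f :: circle \<Rightarrow> real. continuous_on UNIV f \<Longrightarrow>
      average R (\<lambda>r. w r * f (circle_mult r \<alpha>)) \<longlonglongrightarrow> (\<integral>x. \<rho> x * f x \<partial>M)"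
  shows "AE x in M. \<rho> x \<le> s"
proof -
  have M: "prob_space M" "sets M = sets borel"
    using limit_measure_good[OF R] by (auto simp: M_def)
  interpret prob_space M by fact
  define D where "D = density M (\<lambda>x. ennreal (\<rho> x))"
  have [measurable]: "\<rho> \<in> borel_measurable M"
    using \<rho> by simp
  have "has_weak_limit (weighted_measure R w \<alpha>) D"
    unfolding D_def using M(2) w(1) \<rho> lim by (rule has_weak_limit_density)
  then have D: "prob_space D" "sets D = sets borel"
    by (auto simp: has_weak_limit_def)
  interpret D: prob_space D by fact
  define A where "A = {x \<in> space M. s < \<rho> x}"
  have A [measurable]: "A \<in> sets M"
    unfolding A_def by measurable
  have integral_D: "(\<integral>x. f x \<partial>D) = (\<integral>x. \<rho> x * f x \<partial>M)" if "f \<in> borel_measurable M" for f :: "circle \<Rightarrow> real"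
    unfolding D_def using \<rho> that by (subst integral_density) auto
  have "measure D A \<le> s * measure M A + 0"
  proof (rule measure_le_of_continuous[OF finite_measure_axioms M(2) D.finite_measure_axioms D(2) \<open>0 \<le> s\<close>])
    show "A \<in> sets borel"
      using A M by simp
    fix f :: "circle \<Rightarrow> real" assume f: "continuous_on UNIV f" "\<And>x. 0 \<le> f x"
    have "average R (\<lambda>r. w r * f (circle_mult r \<alpha>)) N \<le> s * average R (\<lambda>r. f (circle_mult r \<alpha>)) N" for N
      unfolding average_cmult[symmetric] using w f by (intro average_mono mult_right_mono) auto
    moreover have "(\<lambda>N. s * average R (\<lambda>r. f (circle_mult r \<alpha>)) N) \<longlonglongrightarrow> s * (\<integral>x. f x \<partial>M)"
      unfolding M_def by (intro tendsto_mult tendsto_const limit_measure_good(3)[OF R] f)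
    ultimately have "(\<integral>x. \<rho> x * f x \<partial>M) \<le> s * (\<integral>x. f x \<partial>M)"
      using lim[OF f(1)] by (intro LIMSEQ_le) auto
    moreover have "f \<in> borel_measurable M"
      using integrable_continuous_circle[OF f(1) finite_measure_axioms M(2)] by simp
    ultimately show "(\<integral>x. f x \<partial>D) \<le> s * (\<integral>x. f x \<partial>M) + 0"
      by (simp add: integral_D)
  qed
  moreover have "measure D A = (\<integral>x. \<rho> x * indicator A x \<partial>M)"
  proof -
    have "A \<subseteq> space D"
      using sets.sets_into_space[OF A] by (simp add: D_def)
    then have "measure D A = (\<integral>x. indicator A x \<partial>D)"
      by (simp add: Int_absorb2)
    also have "\<dots> = (\<integral>x. \<rho> x * indicator A x \<partial>M)"
      by (rule integral_D) simp
    finally show ?thesis .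
  qed
  moreover have i: "integrable M (\<lambda>x. \<rho> x * indicator A x)" "integrable M (\<lambda>x. s * indicator A x)"
    using \<rho>(1) A by (auto intro!: integrable_mult_indicator integrable_real_mult_indicator simp: emeasure_finite less_top[symmetric])
  ultimately have "(\<integral>x. \<rho> x * indicator A x - s * indicator A x \<partial>M) \<le> 0"
    by (simp add: Int_absorb2 sets.sets_into_space[OF A])
  moreover have nn: "0 \<le> \<rho> x * indicator A x - s * indicator A x" for x
    by (auto simp: A_def indicator_def)
  ultimately have "(\<integral>x. \<rho> x * indicator A x - s * indicator A x \<partial>M) = 0"
    by (intro antisym integral_nonneg) auto
  then have "AE x in M. \<rho> x * indicator A x - s * indicator A x = 0"
    using i nn by (subst (asm) integral_nonneg_eq_0_iff_AE) auto
  then show ?thesis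
    using AE_space by eventually_elim (auto simp: A_def indicator_def)
qed

section \<open>Limit measures of integrable weights\<close>

text \<open>A bounded weight close to the given one makes its limit measure dominated by a multiple of the limit
  measure of the set, up to a small error. Positivity of the seminorm provides infinitely many \<open>N\<close> with
  averages bounded below; only along these can the error be divided by the mass, which is enough because
  both sides converge.\<close>

lemma weight_limit_measure_absolutely_continuous:
  assumes R: "good_set R" and w: "good_weight R w" "integrable_weight R w" and pos: "seminorm1 R w > 0"
  shows "absolutely_continuous (limit_measure R \<beta>) (weight_limit_measure R w \<beta>)"
proof -
  define M where "M = limit_measure R \<beta>"
  define N where "N = weight_limit_measure R w \<beta>"
  have M: "prob_space M" "sets M = sets borel"
    using limit_measure_good[OF R] by (auto simp: M_def)
  interpret M: prob_space M by fact
  have lim_w: "has_weak_limit (weighted_measure R w \<beta>) N"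
    unfolding N_def by (rule has_weak_limit_weight_limit_measure[OF w(1)])
  then have N: "prob_space N" "sets N = sets borel"
    by (auto simp: has_weak_limit_def)
  interpret N: prob_space N by fact
  have w_nn: "0 \<le> w r" if "r \<in> R" for r
    using w that by (auto simp: good_weight_def is_weight_def)
  obtain \<delta> where \<delta>: "\<delta> > 0" "ereal \<delta> < seminorm1 R w"
    using ereal_dense2[OF pos] by auto
  have freq: "frequently (\<lambda>n. average R w n > \<delta>) sequentially"
  proof (rule ccontr)
    assume "\<not> frequently (\<lambda>n. average R w n > \<delta>) sequentially"
    then have "eventually (\<lambda>n. average R w n \<le> \<delta>) sequentially"
      by (simp add: not_frequently not_less)
    moreover have "average R (\<lambda>r. \<bar>w r\<bar>) n \<le> average R w n" for n
      using w_nn by (intro average_mono) auto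
    ultimately have "seminorm1 R w \<le> ereal \<delta>"
      unfolding seminorm1_eq by (intro Limsup_bounded) (auto elim!: eventually_mono intro: order_trans)
    with \<delta> show False
      by simp
  qed
  have main: "\<exists>C\<ge>0. \<forall>f :: circle \<Rightarrow> real. continuous_on UNIV f \<longrightarrow> (\<forall>x. 0 \<le> f x) \<longrightarrow> (\<forall>x. f x \<le> 1) \<longrightarrow>
      (\<integral>x. f x \<partial>N) \<le> C * (\<integral>x. f x \<partial>M) + e" if "e > 0" for e
  proof -
    have "\<delta> * e > 0"
      using \<delta> that by simp
    then obtain v where v: "sup_norm R v < \<infinity>" "seminorm1 R (\<lambda>r. v r - w r) < ereal (\<delta> * e)"
      using w(2) unfolding integrable_weight_def by blast
    obtain C where C: "C \<ge> 0" "\<And>r. r \<in> R \<Longrightarrow> v r \<le> C"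
    proof -
      define C where "C = max 0 (real_of_ereal (sup_norm R v))"
      have "v r \<le> C" if "r \<in> R" for r
      proof -
        have "ereal (v r) \<le> sup_norm R v"
          unfolding sup_norm_def using that by (intro SUP_upper)
        then show ?thesis
          using v(1) by (cases "sup_norm R v") (auto simp: C_def)
      qed
      then show ?thesis
        using that[of C] by (simp add: C_def)
    qed
    have ev: "eventually (\<lambda>n. average R (\<lambda>r. \<bar>v r - w r\<bar>) n < \<delta> * e) sequentially"
      using Limsup_lessD[OF v(2)[unfolded seminorm1_eq]] by simp
    have "(\<integral>x. f x \<partial>N) \<le> C / \<delta> * (\<integral>x. f x \<partial>M) + e"
      if f: "continuous_on UNIV f" "\<And>x. 0 \<le> f x" "\<And>x. f x \<le> 1" for f :: "circle \<Rightarrow> real"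
    proof (rule ccontr)
      let ?f = "\<lambda>r. f (circle_mult r \<beta>)"
      assume "\<not> (\<integral>x. f x \<partial>N) \<le> C / \<delta> * (\<integral>x. f x \<partial>M) + e"
      moreover have "(\<lambda>n. (\<integral>x. f x \<partial>weighted_measure R w \<beta> n) - (C / \<delta> * average R ?f n + e))
          \<longlonglongrightarrow> (\<integral>x. f x \<partial>N) - (C / \<delta> * (\<integral>x. f x \<partial>M) + e)"
        using lim_w limit_measure_good(3)[OF R f(1), of \<beta>] f(1)
        by (intro tendsto_intros) (auto simp: has_weak_limit_def M_def)
      ultimately have "eventually (\<lambda>n. (\<integral>x. f x \<partial>weighted_measure R w \<beta> n) - (C / \<delta> * average R ?f n + e) > 0) sequentially"
        by (intro order_tendstoD(1)) auto
      with ev have "eventually (\<lambda>n. \<not> average R w n > \<delta>) sequentially"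
      proof eventually_elim
        case (elim n)
        show ?case
        proof
          assume big: "average R w n > \<delta>"
          have "average R (\<lambda>r. w r * ?f r) n \<le> average R (\<lambda>r. C * ?f r + \<bar>v r - w r\<bar>) n"
          proof (rule average_mono)
            fix r assume r: "r \<in> R"
            have "w r * ?f r = v r * ?f r + (w r - v r) * ?f r"
              by (simp add: algebra_simps)
            also have "v r * ?f r \<le> C * ?f r"
              using C(2)[OF r] f by (intro mult_right_mono)
            also have "(w r - v r) * ?f r \<le> \<bar>v r - w r\<bar> * 1"
              using f by (intro mult_mono) auto
            finally show "w r * ?f r \<le> C * ?f r + \<bar>v r - w r\<bar>"
              by simp
          qed
          also have "\<dots> < C * average R ?f n + \<delta> * e"
            using elim(1) by (simp add: average_add average_cmult)
          finally have less: "average R (\<lambda>r. w r * ?f r) n < C * average R ?f n + \<delta> * e" .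
          have "0 \<le> average R (\<lambda>r. w r * ?f r) n"
            using w_nn f by (auto simp: average_def initial_segment_def intro!: divide_nonneg_nonneg sum_nonneg)
          then have "average R (\<lambda>r. w r * ?f r) n / average R w n \<le> average R (\<lambda>r. w r * ?f r) n / \<delta>"
            using big \<delta> by (intro divide_left_mono) auto
          also have "\<dots> \<le> (C * average R ?f n + \<delta> * e) / \<delta>"
            using less \<delta> by (intro divide_right_mono) auto
          also have "\<dots> = C / \<delta> * average R ?f n + e"
            using \<delta> by (simp add: field_simps)
          finally show False
            using elim(2) integral_weighted_measure[of R w f \<beta> n] w_nn f(1) by simp
        qed
      qed
      with freq show False
        by (simp add: frequently_def)
    qed
    then show ?thesis
      using C \<delta> by (intro exI[of _ "C / \<delta>"]) auto
  qed
  show ?thesis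
    unfolding absolutely_continuous_def M_def[symmetric] N_def[symmetric]
  proof
    fix A assume A: "A \<in> null_sets M"
    then have A_borel: "A \<in> sets borel"
      using M by auto
    have "measure N A \<le> e" if "e > 0" for e
    proof -
      obtain C where "C \<ge> 0" and C: "\<And>f :: circle \<Rightarrow> real. continuous_on UNIV f \<Longrightarrow> (\<And>x. 0 \<le> f x) \<Longrightarrow> (\<And>x. f x \<le> 1) \<Longrightarrow>
          (\<integral>x. f x \<partial>N) \<le> C * (\<integral>x. f x \<partial>M) + e"
        using main[OF \<open>e > 0\<close>] by blast
      have "measure N A \<le> C * measure M A + e"
        by (rule measure_le_of_continuous[OF M.finite_measure_axioms M(2) N.finite_measure_axioms N(2) \<open>C \<ge> 0\<close> A_borel C])
      then show ?thesis
        using A by (simp add: measure_def null_setsD1)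
    qed
    then have "measure N A \<le> 0"
      using field_le_epsilon[of "measure N A" 0] by simp
    then show "A \<in> null_sets N"
      using A_borel N by (auto simp: null_sets_def N.emeasure_eq_measure measure_le_0_iff)
  qed
qed

theorem mainTheorem8:
  fixes R :: "nat set"
  assumes "good_set R"
  shows "(\<forall>(\<alpha>::real) (\<rho> :: circle \<Rightarrow> real).
            \<alpha> \<notin> \<rat>
            \<and> integrable (limit_measure R (abs_circle \<alpha>)) \<rho>
            \<and> (AE x in limit_measure R (abs_circle \<alpha>). 0 \<le> \<rho> x)
            \<and> (\<integral>x. \<rho> x \<partial>(limit_measure R (abs_circle \<alpha>))) = 1 \<longrightarrow>
            (\<exists>w. integrable_weight R w \<and> has_mean R w 1
               \<and> represents R w
                    (density (limit_measure R (abs_circle \<alpha>)) (\<lambda>x. ennreal (\<rho> x)))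
                    (abs_circle \<alpha>))
            \<and> (Linf_norm (limit_measure R (abs_circle \<alpha>)) \<rho> < \<infinity> \<longrightarrow>
               (\<exists>w. integrable_weight R w \<and> has_mean R w 1
                  \<and> represents R w
                       (density (limit_measure R (abs_circle \<alpha>)) (\<lambda>x. ennreal (\<rho> x)))
                       (abs_circle \<alpha>)
                  \<and> sup_norm R w = Linf_norm (limit_measure R (abs_circle \<alpha>)) \<rho>)))
       \<and> (\<forall>w. good_weight R w \<and> integrable_weight R w \<and> seminorm1 R w > 0 \<longrightarrow>
            (\<forall>\<beta>. absolutely_continuous (limit_measure R \<beta>) (weight_limit_measure R w \<beta>)))"
proof (intro conjI allI impI; (elim conjE)?)
  fix w \<beta> assume "good_weight R w" "integrable_weight R w" "seminorm1 R w > 0"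
  then show "absolutely_continuous (limit_measure R \<beta>) (weight_limit_measure R w \<beta>)"
    by (intro weight_limit_measure_absolutely_continuous assms)
next
  fix \<alpha> :: real and \<rho> :: "circle \<Rightarrow> real"
  let ?M = "limit_measure R (abs_circle \<alpha>)"
  assume \<rho>: "integrable ?M \<rho>" "AE x in ?M. 0 \<le> \<rho> x" "(\<integral>x. \<rho> x \<partial>?M) = 1"
  have M: "prob_space ?M" "sets ?M = sets borel"
    using limit_measure_good[OF assms] by auto
  interpret prob_space ?M by fact
  note exists = representing_weight_exists[OF assms refl \<rho>]
  have props: "has_mean R w 1" "represents R w (density ?M (\<lambda>x. ennreal (\<rho> x))) (abs_circle \<alpha>)"
    if "good_weight R w" and nn: "\<And>r. 0 \<le> w r" and lim: "\<And>f :: circle \<Rightarrow> real. continuous_on UNIV f \<Longrightarrow>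
       average R (\<lambda>r. w r * f (circle_mult r (abs_circle \<alpha>))) \<longlonglongrightarrow> (\<integral>x. \<rho> x * f x \<partial>?M)" for w
  proof -
    show "has_mean R w 1"
      using lim[of "\<lambda>x. 1"] \<rho>(3) by (simp add: has_mean_iff)
    have "has_weak_limit (weighted_measure R w (abs_circle \<alpha>)) (density ?M (\<lambda>x. ennreal (\<rho> x)))"
      using M(2) nn \<rho> lim by (rule has_weak_limit_density)
    then show "represents R w (density ?M (\<lambda>x. ennreal (\<rho> x))) (abs_circle \<alpha>)"
      using that by (simp add: represents_def weight_limit_measure_def weak_limit_eqI)
  qed
  show "\<exists>w. integrable_weight R w \<and> has_mean R w 1
      \<and> represents R w (density ?M (\<lambda>x. ennreal (\<rho> x))) (abs_circle \<alpha>)"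
  proof -
    obtain w where w: "integrable_weight R w" "good_weight R w" "\<And>r. 0 \<le> w r"
      "\<And>f :: circle \<Rightarrow> real. continuous_on UNIV f \<Longrightarrow>
        average R (\<lambda>r. w r * f (circle_mult r (abs_circle \<alpha>))) \<longlonglongrightarrow> (\<integral>x. \<rho> x * f x \<partial>?M)"
      using exists[of \<infinity>] by auto
    with props[of w] show ?thesis
      by blast
  qed
  show "\<exists>w. integrable_weight R w \<and> has_mean R w 1
      \<and> represents R w (density ?M (\<lambda>x. ennreal (\<rho> x))) (abs_circle \<alpha>)
      \<and> sup_norm R w = Linf_norm ?M \<rho>" if fin: "Linf_norm ?M \<rho> < \<infinity>"
  proof -
    let ?C = "Linf_norm ?M \<rho>"
    have AE_C: "AE x in ?M. ereal (\<rho> x) \<le> ?C"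
      using esssup_AE[of "\<lambda>x. ereal \<bar>\<rho> x\<bar>" ?M] \<rho>(2)
      unfolding Linf_norm_def by eventually_elim simp
    moreover have "0 \<le> ?C"
    proof -
      have "AE x in ?M. 0 \<le> ?C"
        using AE_C \<rho>(2) by eventually_elim (metis ereal_less_eq(3) order_trans zero_ereal_def)
      then show ?thesis
        by (simp add: AE_const)
    qed
    ultimately obtain w where w: "integrable_weight R w" "good_weight R w" "\<And>r. 0 \<le> w r" "\<And>r. ereal (w r) \<le> ?C"
      "\<And>f :: circle \<Rightarrow> real. continuous_on UNIV f \<Longrightarrow>
        average R (\<lambda>r. w r * f (circle_mult r (abs_circle \<alpha>))) \<longlonglongrightarrow> (\<integral>x. \<rho> x * f x \<partial>?M)"
      using exists[of ?C] by blast
    have le: "sup_norm R w \<le> ?C"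
      unfolding sup_norm_def using w(4) by (intro SUP_least)
    have "R \<noteq> {}"
      using assms by (auto simp: good_set_def)
    then obtain r where "r \<in> R" by blast
    then have "ereal (w r) \<le> sup_norm R w"
      unfolding sup_norm_def by (intro SUP_upper)
    then have "0 \<le> sup_norm R w"
      using w(3)[of r] by (metis ereal_less_eq(3) order_trans zero_ereal_def)
    then obtain s where s: "sup_norm R w = ereal s" "0 \<le> s"
      using le fin by (cases "sup_norm R w") auto
    have "w r \<le> s" if "r \<in> R" for r
      using that SUP_upper[of r R "\<lambda>r. ereal (w r)"] s(1) by (simp add: sup_norm_def)
    then have "AE x in ?M. \<rho> x \<le> s"
      using w(3) s(2) by (intro AE_density_le_of_weight_le[OF assms refl \<rho> _ _ _ w(5)]) auto
    then have "AE x in ?M. ereal \<bar>\<rho> x\<bar> \<le> ereal s"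
      using \<rho>(2) by eventually_elim simp
    then have "?C \<le> sup_norm R w"
      unfolding Linf_norm_def s(1) using \<rho>(1) by (intro esssup_I) auto
    with le w props[of w] show ?thesis
      by (metis antisym)
  qed
qed

end
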